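(* Let $S$ be a finite set. There is a separable, universal, ultrahomogeneous (complete, non-degenerate) $S$-valued stochastic process $(\mathbb{X}_t)_{t\in\mathbb{T}}$, and it is unique up to isomorphism.
   Context: Let $S$ be a finite set. An $S$-valued stochastic process $(X_t)_{t\in T}$ is a family of $S$-valued random variables on a probability space indexed by an arbitrary set $T$; processes are considered only through their finite-dimensional distributions $F_{t_1,\dots,t_k}(s_1,\dots,s_k)=\mathbb{P}(X_{t_1}=s_1,\dots,X_{t_k}=s_k)$. For $S$-valued processes $(X_t)_{t\in T}$ and $(Y_u)_{u\in U}$: - A map $\phi\colon T\to U$ embeds $(T,X)$ in $(U,Y)$ if the finite-dimensional distributions of $(Y_{\phi(t)})_{t\in T}$ are identical to those of $(X_t)_{t\in T}$. It is an isomorphism if in addition $\phi$ is onto; an automorphism is an isomorphism from a process to itself. - The process $X$ is non-degenerate if $d(t_1,t_2):=\mathbb{P}(X_{t_1}\ne X_{t_2})>0$ for all $t_1\neq t_2$; then $d$ is a metric on $T$. It is separable (respectively complete) if $(T,d)$ is a separable (respectively complete) metric space. It is finite if $T$ is finite. - A process is universal if every finite $S$-valued stochastic process can be embedded in it. - A finite partial isomorphism from $(X_t)_{t\in T}$ to $(Y_u)_{u\in U}$ is a map $\phi\colon T_0\to U$, with $T_0\subseteq T$ finite, that embeds $(X_t)_{t\in T_0}$ in $(Y_u)_{u\in U}$. - A process is ultrahomogeneous if every finite partial isomorphism from the process to itself can be extended to an automorphism. *)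

theory Defs
  imports "HOL-Probability.Probability"
begin

text \<open>
  An \<open>S\<close>-valued process with index set \<open>T\<close> is a family \<open>X\<close> of random variables on a probability
  space \<open>M\<close>; only the values \<open>X t\<close> with \<open>t \<in> T\<close> matter. Both \<open>S\<close> and \<open>T\<close> are sets rather than
  types, so empty \<open>S\<close> and empty \<open>T\<close> are allowed (empty \<open>S\<close> forces empty \<open>T\<close>).
\<close>

definition stochastic_process ::
  "'s set \<Rightarrow> 't set \<Rightarrow> 'w measure \<Rightarrow> ('t \<Rightarrow> 'w \<Rightarrow> 's) \<Rightarrow> bool" where
  "stochastic_process S T M X \<longleftrightarrow>
     prob_space M \<and> (\<forall>t\<in>T. X t \<in> M \<rightarrow>\<^sub>M count_space S)"

definition fdd :: "'w measure \<Rightarrow> ('t \<Rightarrow> 'w \<Rightarrow> 's) \<Rightarrow> 't list \<Rightarrow> 's list \<Rightarrow> real" where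
  "fdd M X ts ss = measure M {w \<in> space M. map (\<lambda>t. X t w) ts = ss}"

definition embeds ::
  "'s set \<Rightarrow> 't set \<Rightarrow> 'w measure \<Rightarrow> ('t \<Rightarrow> 'w \<Rightarrow> 's) \<Rightarrow>
   'u set \<Rightarrow> 'v measure \<Rightarrow> ('u \<Rightarrow> 'v \<Rightarrow> 's) \<Rightarrow> ('t \<Rightarrow> 'u) \<Rightarrow> bool" where
  "embeds S T M X U N Y \<phi> \<longleftrightarrow>
     \<phi> \<in> T \<rightarrow> U \<and>
     (\<forall>ts \<in> lists T. \<forall>ss \<in> lists S. length ss = length ts \<longrightarrow>
        fdd N (\<lambda>t. Y (\<phi> t)) ts ss = fdd M X ts ss)"

definition process_iso ::
  "'s set \<Rightarrow> 't set \<Rightarrow> 'w measure \<Rightarrow> ('t \<Rightarrow> 'w \<Rightarrow> 's) \<Rightarrow>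
   'u set \<Rightarrow> 'v measure \<Rightarrow> ('u \<Rightarrow> 'v \<Rightarrow> 's) \<Rightarrow> ('t \<Rightarrow> 'u) \<Rightarrow> bool" where
  "process_iso S T M X U N Y \<phi> \<longleftrightarrow> embeds S T M X U N Y \<phi> \<and> \<phi> ` T = U"

definition process_automorphism ::
  "'s set \<Rightarrow> 't set \<Rightarrow> 'w measure \<Rightarrow> ('t \<Rightarrow> 'w \<Rightarrow> 's) \<Rightarrow> ('t \<Rightarrow> 't) \<Rightarrow> bool" where
  "process_automorphism S T M X \<phi> \<longleftrightarrow> process_iso S T M X T M X \<phi>"

definition process_dist :: "'w measure \<Rightarrow> ('t \<Rightarrow> 'w \<Rightarrow> 's) \<Rightarrow> 't \<Rightarrow> 't \<Rightarrow> real" where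
  "process_dist M X t u = measure M {w \<in> space M. X t w \<noteq> X u w}"

definition nondegenerate_process ::
  "'t set \<Rightarrow> 'w measure \<Rightarrow> ('t \<Rightarrow> 'w \<Rightarrow> 's) \<Rightarrow> bool" where
  "nondegenerate_process T M X \<longleftrightarrow>
     (\<forall>t\<in>T. \<forall>u\<in>T. t \<noteq> u \<longrightarrow> process_dist M X t u > 0)"

text \<open>
  The next two notions are meant for non-degenerate processes, for which \<open>(T, process_dist M X)\<close>
  is a metric space (lemma \<open>Metric_space_process_dist\<close> below).
\<close>

definition separable_process :: "'t set \<Rightarrow> 'w measure \<Rightarrow> ('t \<Rightarrow> 'w \<Rightarrow> 's) \<Rightarrow> bool" where
  "separable_process T M X \<longleftrightarrow> separable_space (Metric_space.mtopology T (process_dist M X))"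

definition complete_process :: "'t set \<Rightarrow> 'w measure \<Rightarrow> ('t \<Rightarrow> 'w \<Rightarrow> 's) \<Rightarrow> bool" where
  "complete_process T M X \<longleftrightarrow> Metric_space.mcomplete T (process_dist M X)"

text \<open>
  A definition cannot quantify over the types carrying the finite processes to be embedded, so
  universality is stated for finite processes indexed by natural numbers and living on a path
  space. Lemma \<open>universal_process_embeds\<close> below shows that this covers finite processes over
  arbitrary index types and arbitrary probability spaces.
\<close>

definition universal_process ::
  "'s set \<Rightarrow> 't set \<Rightarrow> 'w measure \<Rightarrow> ('t \<Rightarrow> 'w \<Rightarrow> 's) \<Rightarrow> bool" where
  "universal_process S T M X \<longleftrightarrow>
     (\<forall>(I :: nat set) (N :: (nat \<Rightarrow> 's) measure) Z.
        finite I \<longrightarrow> stochastic_process S I N Z \<longrightarrow> (\<exists>\<phi>. embeds S I N Z T M X \<phi>))"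

definition finite_partial_iso ::
  "'s set \<Rightarrow> 't set \<Rightarrow> 'w measure \<Rightarrow> ('t \<Rightarrow> 'w \<Rightarrow> 's) \<Rightarrow>
   'u set \<Rightarrow> 'v measure \<Rightarrow> ('u \<Rightarrow> 'v \<Rightarrow> 's) \<Rightarrow> 't set \<Rightarrow> ('t \<Rightarrow> 'u) \<Rightarrow> bool" where
  "finite_partial_iso S T M X U N Y T0 \<phi> \<longleftrightarrow>
     finite T0 \<and> T0 \<subseteq> T \<and> embeds S T0 M X U N Y \<phi>"

definition ultrahomogeneous_process ::
  "'s set \<Rightarrow> 't set \<Rightarrow> 'w measure \<Rightarrow> ('t \<Rightarrow> 'w \<Rightarrow> 's) \<Rightarrow> bool" where
  "ultrahomogeneous_process S T M X \<longleftrightarrow>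
     (\<forall>T0 \<phi>. finite_partial_iso S T M X T M X T0 \<phi> \<longrightarrow>
        (\<exists>\<psi>. process_automorphism S T M X \<psi> \<and> (\<forall>t\<in>T0. \<psi> t = \<phi> t)))"

definition urysohn_process ::
  "'s set \<Rightarrow> 't set \<Rightarrow> 'w measure \<Rightarrow> ('t \<Rightarrow> 'w \<Rightarrow> 's) \<Rightarrow> bool" where
  "urysohn_process S T M X \<longleftrightarrow>
     stochastic_process S T M X \<and> nondegenerate_process T M X \<and>
     separable_process T M X \<and> complete_process T M X \<and>
     universal_process S T M X \<and> ultrahomogeneous_process S T M X"

lemma process_neq_sets:
  assumes "finite S" "stochastic_process S T M X" "t \<in> T" "u \<in> T"
  shows "{w \<in> space M. X t w \<noteq> X u w} \<in> sets M"
proof -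
  have X: "X v \<in> M \<rightarrow>\<^sub>M count_space S" if "v \<in> {t, u}" for v
    using assms that by (auto simp: stochastic_process_def)
  have "{w \<in> space M. X t w \<noteq> X u w} =
        (\<Union>s\<in>S. (X t -` {s} \<inter> space M) - (X u -` {s} \<inter> space M))"
    using measurable_space[OF X] by auto
  also have "\<dots> \<in> sets M"
    using assms(1) X by (intro sets.finite_UN sets.Diff measurable_sets[OF X]) auto
  finally show ?thesis .
qed

lemma Metric_space_process_dist:
  assumes S: "finite S" and X: "stochastic_process S T M X" and nd: "nondegenerate_process T M X"
  shows "Metric_space T (process_dist M X)"
proof
  interpret prob_space M using X by (simp add: stochastic_process_def)
  fix x y z
  show "0 \<le> process_dist M X x y" by (simp add: process_dist_def)
  show "process_dist M X x y = process_dist M X y x"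
    unfolding process_dist_def by (rule arg_cong[where f = "measure M"]) auto
  show "process_dist M X x y = 0 \<longleftrightarrow> x = y" if "x \<in> T" "y \<in> T"
  proof
    show "x = y" if "process_dist M X x y = 0"
      using that nd \<open>x \<in> T\<close> \<open>y \<in> T\<close> by (force simp: nondegenerate_process_def)
  qed (simp add: process_dist_def)
  assume T: "x \<in> T" "y \<in> T" "z \<in> T"
  have "process_dist M X x z \<le>
        measure M ({w \<in> space M. X x w \<noteq> X y w} \<union> {w \<in> space M. X y w \<noteq> X z w})"
    unfolding process_dist_def
    using process_neq_sets[OF S X] T by (intro finite_measure_mono) auto
  also have "\<dots> \<le> process_dist M X x y + process_dist M X y z"
    unfolding process_dist_def
    using process_neq_sets[OF S X] T by (intro measure_Un_le) auto
  finally show "process_dist M X x z \<le> process_dist M X x y + process_dist M X y z" .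
qed

lemma universal_process_embeds:
  fixes I :: "'i set" and N :: "'p measure" and Z :: "'i \<Rightarrow> 'p \<Rightarrow> 's"
  assumes S: "finite S" and univ: "universal_process S T M X"
    and I: "finite I" and Z: "stochastic_process S I N Z"
  shows "\<exists>\<phi>. embeds S I N Z T M X \<phi>"
proof -
  interpret N: prob_space N using Z by (simp add: stochastic_process_def)
  have Zm: "Z i \<in> N \<rightarrow>\<^sub>M count_space S" if "i \<in> I" for i
    using Z that by (simp add: stochastic_process_def)
  obtain g :: "'i \<Rightarrow> nat" where g: "inj_on g I"
    using finite_imp_inj_to_nat_seg[OF I] by blast
  define J where "J = g ` I"
  define h where "h = the_inv_into I g"
  have hg: "h (g i) = i" if "i \<in> I" for i
    using that g by (simp add: h_def the_inv_into_f_f)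
  have gJ: "g i \<in> J" if "i \<in> I" for i
    using that by (simp add: J_def)
  define P where "P = (\<Pi>\<^sub>M j\<in>J. count_space S)"
  define F where "F = (\<lambda>w. \<lambda>j\<in>J. Z (h j) w)"
  have F: "F \<in> N \<rightarrow>\<^sub>M P"
    unfolding F_def P_def by (rule measurable_restrict) (auto simp: J_def hg intro!: Zm)
  define N' where "N' = distr N P F"
  define Z' where "Z' = (\<lambda>(j::nat) (w::nat \<Rightarrow> 's). w j)"
  have Z'm: "Z' j \<in> P \<rightarrow>\<^sub>M count_space S" if "j \<in> J" for j
    using that unfolding Z'_def P_def by (rule measurable_component_singleton)
  have "stochastic_process S J N' Z'"
    using Z'm N.prob_space_distr[OF F] by (auto simp: stochastic_process_def N'_def)
  moreover have "finite J" using I by (simp add: J_def)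
  ultimately obtain \<psi> where \<psi>: "embeds S J N' Z' T M X \<psi>"
    using univ unfolding universal_process_def by blast
  have eq: "fdd N' Z' (map g ts) ss = fdd N Z ts ss"
    if ts: "ts \<in> lists I" and ss: "ss \<in> lists S" and len: "length ss = length ts" for ts ss
  proof -
    let ?A = "{w \<in> space P. map (\<lambda>t. Z' t w) (map g ts) = ss}"
    have "?A = {w \<in> space P. \<forall>k\<in>{..<length ts}. Z' (g (ts ! k)) w = ss ! k}"
      using len by (auto simp: list_eq_iff_nth_eq)
    also have "\<dots> \<in> sets P"
    proof (rule sets.sets_Collect_finite_All)
      show "{w \<in> space P. Z' (g (ts ! k)) w = ss ! k} \<in> sets P" if "k \<in> {..<length ts}" for k
      proof -
        have "g (ts ! k) \<in> J" "ss ! k \<in> S"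
          using that ts ss len by (auto simp: J_def)
        then have "Z' (g (ts ! k)) -` {ss ! k} \<inter> space P \<in> sets P"
          by (intro measurable_sets[OF Z'm]) auto
        then show ?thesis by (simp add: vimage_def Int_def conj_commute)
      qed
    qed auto
    finally have A: "?A \<in> sets P" .
    have "fdd N' Z' (map g ts) ss = measure N (F -` ?A \<inter> space N)"
      unfolding fdd_def N'_def using measure_distr[OF F A] by simp
    also have "F -` ?A \<inter> space N = {w \<in> space N. map (\<lambda>t. Z t w) ts = ss}"
    proof -
      have "map (\<lambda>t. Z' t (F w)) (map g ts) = map (\<lambda>t. Z t w) ts" for w
        using ts gJ by (auto simp: Z'_def F_def hg)
      then show ?thesis using measurable_space[OF F] by auto
    qed
    finally show ?thesis by (simp add: fdd_def)
  qed
  have "embeds S I N Z T M X (\<psi> \<circ> g)"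
    unfolding embeds_def
  proof (intro conjI ballI impI)
    show "\<psi> \<circ> g \<in> I \<rightarrow> T" using \<psi> by (auto simp: embeds_def J_def)
    fix ts ss assume *: "ts \<in> lists I" "ss \<in> lists S" "length ss = length ts"
    then have "map g ts \<in> lists J" "length ss = length (map g ts)" by (auto simp: gJ)
    with \<psi> * have "fdd M (\<lambda>t. X (\<psi> t)) (map g ts) ss = fdd N' Z' (map g ts) ss"
      unfolding embeds_def by blast
    with eq[OF *] show "fdd M (\<lambda>t. X ((\<psi> \<circ> g) t)) ts ss = fdd N Z ts ss"
      by (simp add: fdd_def comp_def)
  qed
  then show ?thesis by blast
qed

end

theory Submission
  imports Defs
begin

text \<open>
  The universal process consists of all \<open>S\<close>-valued random variables on the unit interval with Lebesgue
  measure, where variables that agree almost everywhere are identified. Its metric is separable because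
  events can be approximated by finite unions from a countable basis, and complete by a Borel--Cantelli
  argument.

  The decisive property is that the interval is divisible: an event can be cut into parts of any
  prescribed masses. Suppose that some variables are given, together with the law of one more
  coordinate jointly with theirs. Each event on which the given variables have fixed values can be cut
  as this law demands, and the parts define a variable that realises the additional coordinate
  (\<open>forth_propertyI_divisible\<close>). In other words, finite partial isomorphisms into this process extend by
  any further point. Everything else follows from this extension property. Adding points one by one
  embeds every finite process. For ultrahomogeneity, extend a partial isomorphism alternately on both
  sides along countable dense sets. The result matches dense subsets. Finite-dimensional distributions
  are Lipschitz functions of the indices (\<open>fdd_diff_le\<close>), so it extends to the whole complete
  spaces (\<open>back_and_forth\<close>).

  For uniqueness, every universal and ultrahomogeneous process has the extension property: embed
  the enlarged finite process by universality, then correct the embedding by an automorphism so that it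
  agrees with the images already chosen (\<open>forth_propertyI_universal_ultrahomogeneous\<close>). So back and forth
  applies between any two such processes, starting from the empty partial isomorphism.

  If \<open>S\<close> has at most one element, there is at most one variable up to equality, and the process is trivial.
\<close>

section \<open>Joint distributions of finite tuples\<close>

locale finite_valued_process = prob_space M
  for M :: "'w measure" +
  fixes S :: "'s set" and T :: "'t set" and X :: "'t \<Rightarrow> 'w \<Rightarrow> 's"
  assumes finite_S: "finite S"
    and X_measurable: "t \<in> T \<Longrightarrow> X t \<in> M \<rightarrow>\<^sub>M count_space S"
begin

abbreviation d :: "'t \<Rightarrow> 't \<Rightarrow> real" where
  "d \<equiv> process_dist M X"

definition tuples :: "nat \<Rightarrow> 's list set" where
  "tuples n = {ss \<in> lists S. length ss = n}"

lemma finite_tuples: "finite (tuples n)"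
  using finite_lists_length_eq[OF finite_S, of n]
  by (simp add: tuples_def lists_eq_set)

lemma stochastic_process: "stochastic_process S T M X"
  using X_measurable prob_space_axioms by (simp add: stochastic_process_def)

lemma X_in: "t \<in> T \<Longrightarrow> w \<in> space M \<Longrightarrow> X t w \<in> S"
  using measurable_space[OF X_measurable] by simp

lemma map_X_in_tuples:
  "ts \<in> lists T \<Longrightarrow> w \<in> space M \<Longrightarrow> map (\<lambda>t. X t w) ts \<in> tuples (length ts)"
  using X_in by (auto simp: tuples_def)

lemma tuple_value_event:
  assumes "ts \<in> lists T" "ss \<in> lists S"
  shows "{w \<in> space M. map (\<lambda>t. X t w) ts = ss} \<in> events"
  using assms
proof (induction ts arbitrary: ss rule: list.induct)
  case Nil
  then show ?case by simp
next
  case (Cons t ts)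
  show ?case
  proof (cases ss)
    case ss: (Cons s ss')
    with Cons.prems have t: "t \<in> T" "s \<in> S" "ss' \<in> lists S" by auto
    have "{w \<in> space M. map (\<lambda>t. X t w) (t # ts) = ss} =
          (X t -` {s} \<inter> space M) \<inter> {w \<in> space M. map (\<lambda>t. X t w) ts = ss'}"
      using ss by auto
    also have "\<dots> \<in> events"
    proof (rule sets.Int)
      show "X t -` {s} \<inter> space M \<in> events"
        using t by (intro measurable_sets[OF X_measurable]) auto
      show "{w \<in> space M. map (\<lambda>t. X t w) ts = ss'} \<in> events"
        using Cons t by auto
    qed
    finally show ?thesis .
  qed simp
qed

lemma tuple_measurable:
  assumes "ts \<in> lists T"
  shows "(\<lambda>w. map (\<lambda>t. X t w) ts) \<in> M \<rightarrow>\<^sub>M count_space (tuples (length ts))"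
  unfolding measurable_count_space_eq2[OF finite_tuples]
proof (intro conjI ballI)
  show "(\<lambda>w. map (\<lambda>t. X t w) ts) \<in> space M \<rightarrow> tuples (length ts)"
    using map_X_in_tuples[OF assms] by blast
  fix ss assume "ss \<in> tuples (length ts)"
  then have "{w \<in> space M. map (\<lambda>t. X t w) ts = ss} \<in> events"
    using tuple_value_event[OF assms] by (simp add: tuples_def)
  then show "(\<lambda>w. map (\<lambda>t. X t w) ts) -` {ss} \<inter> space M \<in> events"
    by (simp add: vimage_def Int_def conj_commute)
qed

lemma tuple_event:
  assumes "ts \<in> lists T"
  shows "{w \<in> space M. P (map (\<lambda>t. X t w) ts)} \<in> events"
proof -
  have "(\<lambda>w. map (\<lambda>t. X t w) ts) -` {ss \<in> tuples (length ts). P ss} \<inter> space M \<in> events"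
    by (rule measurable_sets[OF tuple_measurable[OF assms]]) auto
  also have "(\<lambda>w. map (\<lambda>t. X t w) ts) -` {ss \<in> tuples (length ts). P ss} \<inter> space M =
             {w \<in> space M. P (map (\<lambda>t. X t w) ts)}"
    using map_X_in_tuples[OF assms] by auto
  finally show ?thesis .
qed

lemma prob_tuple_event:
  assumes "ts \<in> lists T"
  shows "prob {w \<in> space M. P (map (\<lambda>t. X t w) ts)} =
         (\<Sum>ss \<in> {ss \<in> tuples (length ts). P ss}. fdd M X ts ss)"
proof -
  let ?A = "\<lambda>ss. {w \<in> space M. map (\<lambda>t. X t w) ts = ss}"
  have "{w \<in> space M. P (map (\<lambda>t. X t w) ts)} = (\<Union>ss \<in> {ss \<in> tuples (length ts). P ss}. ?A ss)"
    using map_X_in_tuples[OF assms] by auto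
  also have "prob \<dots> = (\<Sum>ss \<in> {ss \<in> tuples (length ts). P ss}. prob (?A ss))"
    using finite_tuples tuple_event[OF assms]
    by (intro finite_measure_finite_Union) (auto simp: disjoint_family_on_def)
  finally show ?thesis by (simp add: fdd_def)
qed

lemma neq_event: "t \<in> T \<Longrightarrow> u \<in> T \<Longrightarrow> {w \<in> space M. X t w \<noteq> X u w} \<in> events"
  by (rule process_neq_sets[OF finite_S stochastic_process])

lemma d_nonneg: "0 \<le> d t u"
  by (simp add: process_dist_def)

lemma d_refl: "d t t = 0"
  by (simp add: process_dist_def)

lemma d_commute: "d t u = d u t"
  unfolding process_dist_def by (rule arg_cong[where f = "measure M"]) auto

lemma d_triangle:
  assumes "t \<in> T" "u \<in> T" "v \<in> T"
  shows "d t v \<le> d t u + d u v"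
proof -
  have "d t v \<le> prob ({w \<in> space M. X t w \<noteq> X u w} \<union> {w \<in> space M. X u w \<noteq> X v w})"
    unfolding process_dist_def using neq_event assms by (intro finite_measure_mono) auto
  also have "\<dots> \<le> d t u + d u v"
    unfolding process_dist_def using neq_event assms by (intro measure_Un_le) auto
  finally show ?thesis .
qed

text \<open>
  Two tuples can only take different values where some coordinates differ, so the finite-dimensional
  distributions are Lipschitz in the indices. This is what lets them pass to limits.
\<close>

lemma fdd_diff_le:
  assumes "set zs \<subseteq> T \<times> T" "ss \<in> lists S"
  shows "\<bar>fdd M X (map fst zs) ss - fdd M X (map snd zs) ss\<bar> \<le> (\<Sum>(t, t') \<leftarrow> zs. d t t')"
proof -
  define D where "D = {w \<in> space M. \<exists>(t, t') \<in> set zs. X t w \<noteq> X t' w}"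
  let ?A = "{w \<in> space M. map (\<lambda>t. X t w) (map fst zs) = ss}"
  let ?B = "{w \<in> space M. map (\<lambda>t. X t w) (map snd zs) = ss}"
  have "D \<in> events \<and> prob D \<le> (\<Sum>(t, t') \<leftarrow> zs. d t t')"
    unfolding D_def using assms(1)
  proof (induction zs)
    case Nil
    then show ?case by simp
  next
    case (Cons z zs)
    obtain t t' where z: "z = (t, t')" by (cases z)
    let ?E = "{w \<in> space M. X t w \<noteq> X t' w}"
    let ?D = "{w \<in> space M. \<exists>(t, t') \<in> set zs. X t w \<noteq> X t' w}"
    have eq: "{w \<in> space M. \<exists>(t, t') \<in> set (z # zs). X t w \<noteq> X t' w} = ?E \<union> ?D"
      by (auto simp: z)
    have E: "?E \<in> events" using Cons.prems by (intro neq_event) (auto simp: z)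
    have IH: "?D \<in> events" "prob ?D \<le> (\<Sum>(t, t') \<leftarrow> zs. d t t')"
      using Cons.IH Cons.prems by auto
    have "prob (?E \<union> ?D) \<le> prob ?E + prob ?D" using E IH(1) by (rule measure_Un_le)
    then show ?case unfolding eq using E IH by (simp add: z process_dist_def)
  qed
  then have D: "D \<in> events" "prob D \<le> (\<Sum>(t, t') \<leftarrow> zs. d t t')" by auto
  have A: "?A \<in> events" and B: "?B \<in> events"
    using assms by (intro tuple_value_event; force)+
  have "map (\<lambda>t. X t w) (map fst zs) = map (\<lambda>t. X t w) (map snd zs)" if "w \<in> space M - D" for w
    using that unfolding D_def by auto
  then have "?A \<subseteq> ?B \<union> D" "?B \<subseteq> ?A \<union> D"
    by auto
  with A B D(1) have "prob ?A \<le> prob ?B + prob D" "prob ?B \<le> prob ?A + prob D"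
    by (meson finite_measure_mono measure_Un_le order_trans sets.Un)+
  with D(2) show ?thesis by (simp add: fdd_def)
qed

lemma separable_process_iff:
  assumes "nondegenerate_process T M X"
  shows "separable_process T M X \<longleftrightarrow>
    (\<exists>D. countable D \<and> D \<subseteq> T \<and> (\<forall>t\<in>T. \<forall>e>0. \<exists>t'\<in>D. d t t' < e))"
proof -
  interpret Metric_space T d
    by (rule Metric_space_process_dist[OF finite_S stochastic_process assms])
  have "mtopology closure_of D = T \<longleftrightarrow> (\<forall>t\<in>T. \<forall>e>0. \<exists>t'\<in>D. d t t' < e)" if "D \<subseteq> T" for D
  proof -
    have "mtopology closure_of D = {t \<in> T. \<forall>e>0. \<exists>t'\<in>D. d t t' < e}"
      using that by (fastforce simp: metric_closure_of)
    then show ?thesis by blast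
  qed
  then show ?thesis
    unfolding separable_process_def separable_space_def topspace_mtopology by meson
qed

end

section \<open>Partial isomorphisms between two processes\<close>

locale process_pair =
  A: finite_valued_process M S T X + B: finite_valued_process N S U Y
  for S :: "'s set" and T :: "'t set" and M :: "'w measure" and X
    and U :: "'u set" and N :: "'v measure" and Y
begin

text \<open>
  Finite partial isomorphisms are handled as lists of pairs. Unlike maps, these are symmetric in the
  two processes and can be extended at the end.
\<close>

definition matching :: "('t \<times> 'u) list \<Rightarrow> bool" where
  "matching ps \<longleftrightarrow> set ps \<subseteq> T \<times> U \<and>
     (\<forall>ss \<in> lists S. length ss = length ps \<longrightarrow>
        fdd M X (map fst ps) ss = fdd N Y (map snd ps) ss)"

lemma matching_carrier:
  assumes "matching ps"
  shows "map fst ps \<in> lists T" "map snd ps \<in> lists U"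
  using assms by (force simp: matching_def)+

lemma matching_prob:
  assumes "matching ps"
  shows "A.prob {w \<in> space M. P (map (\<lambda>t. X t w) (map fst ps))} =
         B.prob {w \<in> space N. P (map (\<lambda>u. Y u w) (map snd ps))}"
  unfolding A.prob_tuple_event[OF matching_carrier(1)[OF assms]]
    B.prob_tuple_event[OF matching_carrier(2)[OF assms]]
  using assms by (intro sum.cong) (auto simp: matching_def A.tuples_def B.tuples_def)

text \<open>
  The joint law of a tuple determines that of every rearrangement of its entries, repetitions and
  omissions included. Hence it is enough to compare the sets of entries.
\<close>

lemma matching_subset:
  assumes ps: "matching ps" and sub: "set qs \<subseteq> set ps"
  shows "matching qs"
  unfolding matching_def
proof (intro conjI ballI impI)
  show "set qs \<subseteq> T \<times> U" using assms by (auto simp: matching_def)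
  fix ss :: "'s list" assume "length ss = length qs"
  have "\<forall>q \<in> set qs. \<exists>i < length ps. ps ! i = q"
    using sub by (meson in_set_conv_nth subsetD)
  then obtain idx where idx: "\<And>q. q \<in> set qs \<Longrightarrow> idx q < length ps \<and> ps ! idx q = q"
    by metis
  \<comment> \<open>\<open>P\<close> expresses the event about \<open>qs\<close> through the values along \<open>ps\<close>.\<close>
  define P :: "'s list \<Rightarrow> bool" where "P = (\<lambda>rs. map (\<lambda>q. rs ! idx q) qs = ss)"
  have "P (map (\<lambda>t. X t w) (map fst ps)) \<longleftrightarrow> map (\<lambda>t. X t w) (map fst qs) = ss" for w
    unfolding P_def using idx by (auto intro!: arg_cong[where f = "\<lambda>xs. xs = ss"])
  moreover have "P (map (\<lambda>t. Y t w) (map snd ps)) \<longleftrightarrow> map (\<lambda>t. Y t w) (map snd qs) = ss" for w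
    unfolding P_def using idx by (auto intro!: arg_cong[where f = "\<lambda>xs. xs = ss"])
  ultimately show "fdd M X (map fst qs) ss = fdd N Y (map snd qs) ss"
    using matching_prob[OF ps, of P] by (simp only: fdd_def)
qed

lemma matching_dist:
  assumes "matching ps" "(t, u) \<in> set ps" "(t', u') \<in> set ps"
  shows "A.d t t' = B.d u u'"
proof -
  have "matching [(t, u), (t', u')]"
    by (rule matching_subset[OF assms(1)]) (use assms in auto)
  from matching_prob[OF this, of "\<lambda>ss. ss ! 0 \<noteq> ss ! 1"] show ?thesis
    by (simp add: process_dist_def)
qed

lemma embeds_iff_matching:
  assumes "T0 \<subseteq> T"
  shows "embeds S T0 M X U N Y \<phi> \<longleftrightarrow>
    \<phi> \<in> T0 \<rightarrow> U \<and> (\<forall>ts \<in> lists T0. matching (map (\<lambda>t. (t, \<phi> t)) ts))"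
proof -
  have "set (map (\<lambda>t. (t, \<phi> t)) ts) \<subseteq> T \<times> U" if "\<phi> \<in> T0 \<rightarrow> U" "ts \<in> lists T0" for ts
    using that assms by auto
  moreover have "fdd N (\<lambda>t. Y (\<phi> t)) ts ss = fdd N Y (map \<phi> ts) ss" for ts ss
    by (simp add: fdd_def comp_def)
  ultimately show ?thesis
    unfolding embeds_def matching_def
    by (auto simp: comp_def eq_commute[of "fdd M X _ _"] simp del: in_lists_conv_set)
qed

lemma matching_swap: "process_pair.matching S U N Y T M X (map prod.swap ps) \<longleftrightarrow> matching ps"
proof -
  interpret swap: process_pair S U N Y T M X ..
  show ?thesis unfolding swap.matching_def matching_def by (auto simp: comp_def) 
qed

subsection \<open>Limits of partial isomorphisms\<close>

text \<open>
  The limits of a family of pairs, taken in both coordinates at once. Everything that is determined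
  by finite-dimensional distributions passes from the family to its limits.
\<close>

definition pair_closure :: "('t \<times> 'u) set \<Rightarrow> ('t \<times> 'u) set" where
  "pair_closure R = {(t, u) \<in> T \<times> U. \<forall>e>0. \<exists>(t', u') \<in> R. A.d t t' < e \<and> B.d u u' < e}"

lemma subset_pair_closure:
  assumes "R \<subseteq> T \<times> U"
  shows "R \<subseteq> pair_closure R"
  using assms unfolding pair_closure_def by (force simp: A.d_refl B.d_refl)

lemma matching_pair_closure:
  assumes R: "\<And>ps. set ps \<subseteq> R \<Longrightarrow> matching ps" and ps: "set ps \<subseteq> pair_closure R"
  shows "matching ps"
  unfolding matching_def
proof (intro conjI ballI impI)
  show carrier: "set ps \<subseteq> T \<times> U" using ps by (auto simp: pair_closure_def)
  fix ss assume ss: "ss \<in> lists S" "length ss = length ps"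
  have "\<bar>fdd M X (map fst ps) ss - fdd N Y (map snd ps) ss\<bar> \<le> 0 + e" if "e > 0" for e :: real
  proof -
    define \<delta> where "\<delta> = e / (2 * length ps + 1)"
    have \<delta>: "\<delta> > 0" "2 * (length ps * \<delta>) \<le> e" using that by (auto simp: \<delta>_def field_simps)
    have "\<forall>p \<in> set ps. \<exists>q. q \<in> R \<and> A.d (fst p) (fst q) < \<delta> \<and> B.d (snd p) (snd q) < \<delta>"
    proof
      fix p assume "p \<in> set ps"
      then have "p \<in> pair_closure R" using ps by blast
      then show "\<exists>q. q \<in> R \<and> A.d (fst p) (fst q) < \<delta> \<and> B.d (snd p) (snd q) < \<delta>"
        using \<delta>(1) unfolding pair_closure_def case_prod_beta mem_Collect_eq by blast
    qed
    from bchoice[OF this] obtain f where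
      "\<forall>p \<in> set ps. f p \<in> R \<and> A.d (fst p) (fst (f p)) < \<delta> \<and> B.d (snd p) (snd (f p)) < \<delta>"
      by blast
    then have f: "\<And>p. p \<in> set ps \<Longrightarrow> f p \<in> R"
        "\<And>p. p \<in> set ps \<Longrightarrow> A.d (fst p) (fst (f p)) \<le> \<delta>"
        "\<And>p. p \<in> set ps \<Longrightarrow> B.d (snd p) (snd (f p)) \<le> \<delta>"
      by (simp_all add: less_imp_le)
    have m: "matching (map f ps)" using f(1) by (intro R) (simp add: image_subset_iff)
    then have fR: "f p \<in> T \<times> U" if "p \<in> set ps" for p using that by (auto simp: matching_def)
    have "\<bar>fdd M X (map fst ps) ss - fdd M X (map fst (map f ps)) ss\<bar> \<le> (\<Sum>p \<leftarrow> ps. A.d (fst p) (fst (f p)))"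
    proof -
      have "set (map (\<lambda>p. (fst p, fst (f p))) ps) \<subseteq> T \<times> T"
        using carrier fR by (fastforce simp: mem_Times_iff)
      from A.fdd_diff_le[OF this ss(1)] show ?thesis by (simp add: comp_def)
    qed
    also have "\<dots> \<le> length ps * \<delta>"
      using sum_list_mono[OF f(2)] by (simp add: sum_list_triv)
    finally have 1: "\<bar>fdd M X (map fst ps) ss - fdd M X (map fst (map f ps)) ss\<bar> \<le> length ps * \<delta>" .
    have "\<bar>fdd N Y (map snd ps) ss - fdd N Y (map snd (map f ps)) ss\<bar> \<le> (\<Sum>p \<leftarrow> ps. B.d (snd p) (snd (f p)))"
    proof -
      have "set (map (\<lambda>p. (snd p, snd (f p))) ps) \<subseteq> U \<times> U"
        using carrier fR by (fastforce simp: mem_Times_iff)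
      from B.fdd_diff_le[OF this ss(1)] show ?thesis by (simp add: comp_def)
    qed
    also have "\<dots> \<le> length ps * \<delta>"
      using sum_list_mono[OF f(3)] by (simp add: sum_list_triv)
    finally have 2: "\<bar>fdd N Y (map snd ps) ss - fdd N Y (map snd (map f ps)) ss\<bar> \<le> length ps * \<delta>" .
    have "fdd M X (map fst (map f ps)) ss = fdd N Y (map snd (map f ps)) ss"
      using m ss unfolding matching_def by simp
    with 1 2 \<delta>(2) show ?thesis by linarith
  qed
  from field_le_epsilon[OF this] show "fdd M X (map fst ps) ss = fdd N Y (map snd ps) ss" by simp
qed

text \<open>
  A sequence in the domain that converges to \<open>t\<close> has a Cauchy sequence of partners, since matched
  pairs have equal distances. Completeness gives the partner of \<open>t\<close>.
\<close>

lemma pair_closure_total: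
  assumes R: "\<And>ps. set ps \<subseteq> R \<Longrightarrow> matching ps"
    and dense: "\<And>e. e > 0 \<Longrightarrow> \<exists>(t', u') \<in> R. A.d t t' < e"
    and nd: "nondegenerate_process U N Y" and complete: "complete_process U N Y"
    and t: "t \<in> T"
  shows "\<exists>u. (t, u) \<in> pair_closure R"
proof -
  interpret Metric_space U "B.d"
    by (rule Metric_space_process_dist[OF B.finite_S B.stochastic_process nd])
  have RTU: "p \<in> T \<times> U" if "p \<in> R" for p
    using R[of "[p]"] that by (auto simp: matching_def)
  have "\<forall>n. \<exists>p \<in> R. A.d t (fst p) < inverse (Suc n)"
  proof
    fix n show "\<exists>p \<in> R. A.d t (fst p) < inverse (Suc n)"
      using dense[of "inverse (Suc n)"] by (force simp del: of_nat_Suc)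
  qed
  then obtain p where p: "\<And>n. p n \<in> R" "\<And>n. A.d t (fst (p n)) < inverse (Suc n)"
    by metis
  have dist: "B.d (snd (p m)) (snd (p n)) < inverse (Suc m) + inverse (Suc n)" for m n
  proof -
    have "B.d (snd (p m)) (snd (p n)) = A.d (fst (p m)) (fst (p n))"
      using matching_dist[OF R[of "[p m, p n]"], of "fst (p m)" "snd (p m)" "fst (p n)" "snd (p n)"] p(1)
      by simp
    also have "\<dots> \<le> A.d (fst (p m)) t + A.d t (fst (p n))"
      using RTU[OF p(1)] t by (intro A.d_triangle) (auto simp: mem_Times_iff)
    also have "\<dots> < inverse (Suc m) + inverse (Suc n)"
      using p(2)[of m] p(2)[of n] by (simp add: A.d_commute)
    finally show ?thesis .
  qed
  have "MCauchy (\<lambda>n. snd (p n))"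
    unfolding MCauchy_def
  proof (intro conjI allI impI)
    show "range (\<lambda>n. snd (p n)) \<subseteq> U" using RTU[OF p(1)] by (auto simp: mem_Times_iff)
    fix e :: real assume "e > 0"
    then obtain K where K: "inverse (Suc K) < e / 2" using reals_Archimedean[of "e / 2"] by auto
    have "inverse (Suc n) < e / 2" if "n \<ge> K" for n
    proof -
      have "inverse (real (Suc n)) \<le> inverse (real (Suc K))"
        using that by (intro le_imp_inverse_le) auto
      with K show ?thesis by linarith
    qed
    then have "B.d (snd (p m)) (snd (p n)) < e" if "K \<le> m" "K \<le> n" for m n
      using dist[of m n] that by (smt (verit) field_sum_of_halves)
    then show "\<exists>K. \<forall>m n. K \<le> m \<longrightarrow> K \<le> n \<longrightarrow> B.d (snd (p m)) (snd (p n)) < e" by blast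
  qed
  then obtain u where "limitin mtopology (\<lambda>n. snd (p n)) u sequentially"
    using complete unfolding complete_process_def mcomplete_def by blast
  then have u: "u \<in> U" "\<And>e. e > 0 \<Longrightarrow> \<exists>K. \<forall>n\<ge>K. B.d (snd (p n)) u < e"
    by (auto simp: limit_metric_sequentially) blast
  have "\<exists>(t', u') \<in> R. A.d t t' < e \<and> B.d u u' < e" if e: "e > 0" for e
  proof -
    obtain K where K: "\<forall>n\<ge>K. B.d (snd (p n)) u < e" using u(2)[OF e] by blast
    obtain L where L: "inverse (Suc L) < e" using reals_Archimedean[OF e] by auto
    let ?n = "max K L"
    have "inverse (real (Suc ?n)) \<le> inverse (real (Suc L))"
      by (intro le_imp_inverse_le) auto
    with L p(2)[of ?n] have "A.d t (fst (p ?n)) < e" by linarith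
    moreover have "B.d u (snd (p ?n)) < e" using K by (simp add: B.d_commute)
    ultimately show ?thesis using p(1)[of ?n] by (auto simp: case_prod_beta)
  qed
  then show ?thesis using t u(1) by (auto simp: pair_closure_def)
qed

lemma matching_imp_functional:
  assumes "matching ps" "(t, u) \<in> set ps" "(t, u') \<in> set ps" "nondegenerate_process U N Y"
  shows "u = u'"
proof (rule ccontr)
  assume "u \<noteq> u'"
  moreover have "u \<in> U" "u' \<in> U" using assms by (auto simp: matching_def)
  ultimately have "B.d u u' > 0" using assms(4) by (auto simp: nondegenerate_process_def)
  with matching_dist[OF assms(1-3)] show False by (simp add: A.d_refl)
qed

subsection \<open>Back and forth\<close>

text \<open>
  Universality, ultrahomogeneity and uniqueness all reduce to these one-point extension properties.
\<close>

definition forth_property :: bool where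
  "forth_property \<longleftrightarrow> (\<forall>ps. matching ps \<longrightarrow> (\<forall>t \<in> T. \<exists>u. matching (ps @ [(t, u)])))"

definition back_property :: bool where
  "back_property \<longleftrightarrow> (\<forall>ps. matching ps \<longrightarrow> (\<forall>u \<in> U. \<exists>t. matching (ps @ [(t, u)])))"

lemma back_property_iff_swap: "back_property \<longleftrightarrow> process_pair.forth_property S U N Y T M X"
proof -
  interpret swap: process_pair S U N Y T M X ..
  have *: "swap.matching qs \<longleftrightarrow> matching (map prod.swap qs)" for qs
    using matching_swap[of "map prod.swap qs"] by (simp add: comp_def)
  show ?thesis
    unfolding back_property_def swap.forth_property_def
  proof safe
    fix ps u assume "\<forall>ps. matching ps \<longrightarrow> (\<forall>u \<in> U. \<exists>t. matching (ps @ [(t, u)]))"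
      "swap.matching ps" "u \<in> U"
    then show "\<exists>t. swap.matching (ps @ [(u, t)])" by (simp add: *)
  next
    fix ps u assume "\<forall>ps. swap.matching ps \<longrightarrow> (\<forall>u \<in> U. \<exists>t. swap.matching (ps @ [(u, t)]))"
      "matching ps" "u \<in> U"
    then obtain t where "swap.matching (map prod.swap ps @ [(u, t)])"
      by (metis matching_swap)
    then show "\<exists>t. matching (ps @ [(t, u)])" by (auto simp: * comp_def)
  qed
qed

text \<open>
  Enumerate both countable sets and let step \<open>n\<close> take in the \<open>n\<close>th point of each of them.
\<close>

lemma countable_exhausting_matching:
  assumes forth_property and back_property and ps0: "matching ps0"
    and D: "countable D" "D \<subseteq> T" and E: "countable E" "E \<subseteq> U"
  obtains R where "set ps0 \<subseteq> R" "D \<subseteq> fst ` R" "E \<subseteq> snd ` R" "\<And>ps. set ps \<subseteq> R \<Longrightarrow> matching ps"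
proof -
  let ?P = "\<lambda>ps. matching ps \<and> set ps0 \<subseteq> set ps"
  let ?Q = "\<lambda>n ps qs. set ps \<subseteq> set qs \<and> (D \<noteq> {} \<longrightarrow> from_nat_into D n \<in> fst ` set qs) \<and>
    (E \<noteq> {} \<longrightarrow> from_nat_into E n \<in> snd ` set qs)"
  have step: "\<exists>qs. ?P qs \<and> ?Q n ps qs" if ps: "?P ps" for ps n
  proof -
    obtain qs where qs: "?P qs" "set ps \<subseteq> set qs" "D \<noteq> {} \<longrightarrow> from_nat_into D n \<in> fst ` set qs"
    proof (cases "D = {}")
      case False
      then have "from_nat_into D n \<in> T" using from_nat_into[of D n] D(2) by auto
      then obtain u where "matching (ps @ [(from_nat_into D n, u)])"
        using \<open>forth_property\<close> ps unfolding forth_property_def by blast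
      with ps show ?thesis by (intro that[of "ps @ [(from_nat_into D n, u)]"]) auto
    qed (use ps that in auto)
    show ?thesis
    proof (cases "E = {}")
      case False
      then have "from_nat_into E n \<in> U" using from_nat_into[of E n] E(2) by auto
      then obtain t where "matching (qs @ [(t, from_nat_into E n)])"
        using \<open>back_property\<close> qs unfolding back_property_def by blast
      with qs show ?thesis by (intro exI[of _ "qs @ [(t, from_nat_into E n)]"]) auto
    qed (use qs in blast)
  qed
  have "\<exists>f. \<forall>n. ?P (f n) \<and> ?Q n (f n) (f (Suc n))"
  proof (rule dependent_nat_choice)
    show "\<exists>ps. ?P ps" using ps0 by blast
  qed (rule step)
  then obtain f where f': "\<forall>n. ?P (f n) \<and> ?Q n (f n) (f (Suc n))" ..
  then have f: "\<And>n. ?P (f n)" "\<And>n. ?Q n (f n) (f (Suc n))"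
    by simp_all
  define R where "R = (\<Union>n. set (f n))"
  have mono: "set (f m) \<subseteq> set (f n)" if "m \<le> n" for m n
    by (rule lift_Suc_mono_le[of "\<lambda>n. set (f n)", OF _ that]) (use f(2) in simp)
  have "\<exists>n. set ps \<subseteq> set (f n)" if "set ps \<subseteq> R" for ps
    using that
  proof (induction ps)
    case (Cons p ps)
    then obtain m n where "p \<in> set (f m)" "set ps \<subseteq> set (f n)" by (auto simp: R_def)
    then have "set (p # ps) \<subseteq> set (f (max m n))"
      using mono[of m "max m n"] mono[of n "max m n"] by auto
    then show ?case by blast
  qed simp
  then have "matching ps" if "set ps \<subseteq> R" for ps
    using that f(1) matching_subset by blast
  moreover have "D \<subseteq> fst ` R"
  proof
    fix x assume x: "x \<in> D"
    then obtain n where "x = from_nat_into D n" using D(1) by (metis from_nat_into_surj)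
    with f(2)[of n] x show "x \<in> fst ` R" by (auto simp: R_def)
  qed
  moreover have "E \<subseteq> snd ` R"
  proof
    fix x assume x: "x \<in> E"
    then obtain n where "x = from_nat_into E n" using E(1) by (metis from_nat_into_surj)
    with f(2)[of n] x show "x \<in> snd ` R" by (auto simp: R_def)
  qed
  moreover have "set ps0 \<subseteq> R" using f(1)[of 0] by (auto simp: R_def)
  ultimately show ?thesis using that by blast
qed

text \<open>
  Exhausting countable dense sets on both sides gives a correspondence between dense subsets that
  respects all finite-dimensional distributions. It preserves distances, so by completeness its
  closure relates every point on either side to a point on the other side, and non-degeneracy makes
  the closure single-valued.
\<close>

theorem back_and_forth:
  assumes forth_property and back_property and ps0: "matching ps0"
    and X: "nondegenerate_process T M X" "separable_process T M X" "complete_process T M X"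
    and Y: "nondegenerate_process U N Y" "separable_process U N Y" "complete_process U N Y"
  shows "\<exists>\<phi>. process_iso S T M X U N Y \<phi> \<and> (\<forall>(t, u) \<in> set ps0. \<phi> t = u)"
proof -
  interpret swap: process_pair S U N Y T M X ..
  obtain D where D: "countable D" "D \<subseteq> T" "\<And>t e. t \<in> T \<Longrightarrow> e > 0 \<Longrightarrow> \<exists>t'\<in>D. A.d t t' < e"
    using X(2) A.separable_process_iff[OF X(1)] by blast
  obtain E where E: "countable E" "E \<subseteq> U" "\<And>u e. u \<in> U \<Longrightarrow> e > 0 \<Longrightarrow> \<exists>u'\<in>E. B.d u u' < e"
    using Y(2) B.separable_process_iff[OF Y(1)] by blast
  obtain R where R: "set ps0 \<subseteq> R" "D \<subseteq> fst ` R" "E \<subseteq> snd ` R" "\<And>ps. set ps \<subseteq> R \<Longrightarrow> matching ps"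
    using countable_exhausting_matching[OF \<open>forth_property\<close> \<open>back_property\<close> ps0 D(1,2) E(1,2)] by blast
  have RTU: "R \<subseteq> T \<times> U"
  proof
    fix p assume "p \<in> R"
    then show "p \<in> T \<times> U" using R(4)[of "[p]"] by (simp add: matching_def)
  qed
  have clos: "matching ps" if "set ps \<subseteq> pair_closure R" for ps
    using matching_pair_closure[of R ps] R(4) that by blast
  have total: "\<exists>u. (t, u) \<in> pair_closure R" if "t \<in> T" for t
  proof (rule pair_closure_total[OF R(4) _ Y(1,3) that])
    fix e :: real assume "e > 0"
    then obtain t' where "t' \<in> D" "A.d t t' < e" using D(3) \<open>t \<in> T\<close> by blast
    then show "\<exists>(t', u') \<in> R. A.d t t' < e" using R(2) by fastforce
  qed
  have onto: "\<exists>t. (t, u) \<in> pair_closure R" if "u \<in> U" for u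
  proof -
    have "\<exists>t. (u, t) \<in> swap.pair_closure (R\<inverse>)"
    proof (rule swap.pair_closure_total[OF _ _ X(1,3) that])
      fix ps assume "set ps \<subseteq> R\<inverse>"
      then have "matching (map prod.swap ps)" by (intro R(4)) auto
      then show "swap.matching ps" using matching_swap[of "map prod.swap ps"] by (simp add: comp_def)
    next
      fix e :: real assume "e > 0"
      then obtain u' where "u' \<in> E" "B.d u u' < e" using E(3) \<open>u \<in> U\<close> by blast
      then show "\<exists>(u', t') \<in> R\<inverse>. B.d u u' < e" using R(3) by fastforce
    qed
    then show ?thesis
      unfolding swap.pair_closure_def pair_closure_def by (auto simp: conj_commute) blast
  qed
  define \<phi> where "\<phi> = (\<lambda>t. SOME u. (t, u) \<in> pair_closure R)"
  have \<phi>: "(t, \<phi> t) \<in> pair_closure R" if "t \<in> T" for t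
    unfolding \<phi>_def using total[OF that] by (rule someI_ex)
  have unique: "\<phi> t = u" if "(t, u) \<in> pair_closure R" for t u
  proof -
    have "t \<in> T" using that by (simp add: pair_closure_def)
    then have "matching [(t, \<phi> t), (t, u)]" using that \<phi> by (intro clos) auto
    then show ?thesis by (rule matching_imp_functional[OF _ _ _ Y(1)]) auto
  qed
  have range: "\<phi> t \<in> U" if "t \<in> T" for t
    using \<phi>[OF that] by (simp add: pair_closure_def)
  have "embeds S T M X U N Y \<phi>"
    unfolding embeds_iff_matching[OF order_refl]
  proof (intro conjI ballI)
    show "\<phi> \<in> T \<rightarrow> U" using range by blast
    show "matching (map (\<lambda>t. (t, \<phi> t)) ts)" if "ts \<in> lists T" for ts
      using that \<phi> by (intro clos) auto
  qed
  moreover have "\<phi> ` T = U"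
  proof (intro subset_antisym subsetI)
    fix u assume "u \<in> U"
    then obtain t where t: "(t, u) \<in> pair_closure R" using onto by blast
    then have "t \<in> T" by (simp add: pair_closure_def)
    with unique[OF t] show "u \<in> \<phi> ` T" by blast
  qed (use range in blast)
  moreover have "\<forall>(t, u) \<in> set ps0. \<phi> t = u"
    using R(1) subset_pair_closure[OF RTU] unique by blast
  ultimately show ?thesis unfolding process_iso_def by blast
qed

subsection \<open>Obtaining extensions by one point\<close>

lemma matching_Nil: "matching []"
  by (simp add: matching_def fdd_def A.prob_space B.prob_space)

lemma matching_imp_partial_iso:
  assumes qs: "matching qs" and nd: "nondegenerate_process U N Y"
  shows "\<exists>\<phi>. finite_partial_iso S T M X U N Y (fst ` set qs) \<phi> \<and> (\<forall>(t, u) \<in> set qs. \<phi> t = u)"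
proof -
  define \<phi> where "\<phi> = (\<lambda>t. SOME u. (t, u) \<in> set qs)"
  have \<phi>: "(t, \<phi> t) \<in> set qs" if t: "t \<in> fst ` set qs" for t
  proof -
    have "\<exists>u. (t, u) \<in> set qs" using t by force
    then show ?thesis unfolding \<phi>_def by (rule someI_ex)
  qed
  have TU: "set qs \<subseteq> T \<times> U" using qs by (simp add: matching_def)
  have T0: "fst ` set qs \<subseteq> T" using TU by force
  have "embeds S (fst ` set qs) M X U N Y \<phi>"
    unfolding embeds_iff_matching[OF T0]
  proof (intro conjI ballI)
    show "\<phi> \<in> fst ` set qs \<rightarrow> U" using \<phi> TU by blast
    fix ts assume "ts \<in> lists (fst ` set qs)"
    then show "matching (map (\<lambda>t. (t, \<phi> t)) ts)"
      using \<phi> by (intro matching_subset[OF qs]) auto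
  qed
  moreover have "\<phi> t = u" if "(t, u) \<in> set qs" for t u
  proof (rule matching_imp_functional[OF qs _ that nd])
    have "fst (t, u) \<in> fst ` set qs" using that by (rule imageI)
    then show "(t, \<phi> t) \<in> set qs" using \<phi> by simp
  qed
  ultimately show ?thesis using T0 unfolding finite_partial_iso_def by (intro exI[of _ \<phi>]) auto
qed

text \<open>
  Universality places a copy of the enlarged finite process somewhere in the target.
  Ultrahomogeneity moves that copy on top of the images that were already chosen.
\<close>

lemma forth_propertyI_universal_ultrahomogeneous:
  assumes nd: "nondegenerate_process U N Y" and univ: "universal_process S U N Y"
    and uh: "ultrahomogeneous_process S U N Y"
  shows forth_property
  unfolding forth_property_def
proof (intro allI impI ballI)
  interpret self: process_pair S U N Y U N Y ..
  fix ps t assume ps: "matching ps" and t: "t \<in> T"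
  let ?ts = "map fst ps" and ?us = "map snd ps"
  define I where "I = insert t (fst ` set ps)"
  have I: "finite I" "I \<subseteq> T" "t \<in> I" "?ts \<in> lists I"
    using ps t by (auto simp: I_def matching_def)
  have "stochastic_process S I M X"
    using A.stochastic_process I(2) by (auto simp: stochastic_process_def)
  then obtain \<psi> where "embeds S I M X U N Y \<psi>"
    using universal_process_embeds[OF A.finite_S univ I(1)] by blast
  then have \<psi>: "\<psi> \<in> I \<rightarrow> U" "\<And>ts. ts \<in> lists I \<Longrightarrow> matching (map (\<lambda>t. (t, \<psi> t)) ts)"
    unfolding embeds_iff_matching[OF I(2)] by blast+
  have \<psi>_fdd: "fdd M X ts ss = fdd N Y (map \<psi> ts) ss"
    if "ts \<in> lists I" "ss \<in> lists S" "length ss = length ts" for ts ss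
    using \<psi>(2)[OF that(1)] that(2,3) by (simp add: matching_def comp_def)
  define qs where "qs = map (\<lambda>(t, u). (\<psi> t, u)) ps"
  have fst_qs: "map fst qs = map \<psi> ?ts" and snd_qs: "map snd qs = ?us"
    by (auto simp: qs_def case_prod_beta)
  have "self.matching qs"
    unfolding self.matching_def fst_qs snd_qs
  proof (intro conjI ballI impI)
    show "set qs \<subseteq> U \<times> U"
    proof
      fix q assume "q \<in> set qs"
      then obtain t' u where q: "(t', u) \<in> set ps" "q = (\<psi> t', u)" by (auto simp: qs_def)
      then have "t' \<in> I" "u \<in> U" using ps by (force simp: I_def, auto simp: matching_def)
      then show "q \<in> U \<times> U" using \<psi>(1) q(2) by auto
    qed
    fix ss assume ss: "ss \<in> lists S" "length ss = length qs"
    then have "fdd M X ?ts ss = fdd N Y ?us ss"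
      using ps by (simp add: matching_def qs_def)
    with \<psi>_fdd[OF I(4) ss(1)] ss(2) show "fdd N Y (map \<psi> ?ts) ss = fdd N Y ?us ss"
      by (simp add: qs_def)
  qed
  from self.matching_imp_partial_iso[OF this nd]
  obtain \<phi> where \<phi>: "finite_partial_iso S U N Y U N Y (fst ` set qs) \<phi>"
      "\<forall>(v, u) \<in> set qs. \<phi> v = u"
    by blast
  then obtain \<alpha> where \<alpha>: "process_automorphism S U N Y \<alpha>" "\<forall>v \<in> fst ` set qs. \<alpha> v = \<phi> v"
    using uh unfolding ultrahomogeneous_process_def by blast
  then have \<alpha>_match: "\<alpha> \<in> U \<rightarrow> U" "\<And>vs. vs \<in> lists U \<Longrightarrow> self.matching (map (\<lambda>v. (v, \<alpha> v)) vs)"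
    unfolding process_automorphism_def process_iso_def self.embeds_iff_matching[OF order_refl]
    by blast+
  have "\<alpha> (\<psi> (fst q)) = snd q" if "q \<in> set ps" for q
  proof -
    have q: "(\<psi> (fst q), snd q) \<in> set qs" using that by (force simp: qs_def)
    then have "\<psi> (fst q) \<in> fst ` set qs" by force
    moreover have "\<phi> (\<psi> (fst q)) = snd q" using bspec[OF \<phi>(2) q] by simp
    ultimately show ?thesis using \<alpha>(2) by metis
  qed
  then have us: "map \<alpha> (map \<psi> (?ts @ [t])) = ?us @ [\<alpha> (\<psi> t)]"
    by simp
  have "matching (ps @ [(t, \<alpha> (\<psi> t))])"
    unfolding matching_def
  proof (intro conjI ballI impI)
    show "set (ps @ [(t, \<alpha> (\<psi> t))]) \<subseteq> T \<times> U"
      using ps t \<alpha>_match(1) \<psi>(1) I(3) by (auto simp: matching_def)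
    fix ss assume ss: "ss \<in> lists S" "length ss = length (ps @ [(t, \<alpha> (\<psi> t))])"
    have "fdd M X (?ts @ [t]) ss = fdd N Y (map \<psi> (?ts @ [t])) ss"
      using ss I(3,4) by (intro \<psi>_fdd) auto
    also have "\<dots> = fdd N Y (map \<alpha> (map \<psi> (?ts @ [t]))) ss"
    proof -
      have "map \<psi> (?ts @ [t]) \<in> lists U" using \<psi>(1) I(3,4) by (force simp: Pi_iff)
      from \<alpha>_match(2)[OF this] ss show ?thesis
        unfolding self.matching_def by (simp add: comp_def)
    qed
    finally show "fdd M X (map fst (ps @ [(t, \<alpha> (\<psi> t))])) ss =
        fdd N Y (map snd (ps @ [(t, \<alpha> (\<psi> t))])) ss"
      unfolding us by simp
  qed
  then show "\<exists>u. matching (ps @ [(t, u)])" ..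
qed

text \<open>
  A finite process is embedded by placing its indices one after the other.
\<close>

lemma forth_property_imp_embeds:
  assumes forth: forth_property and T: "finite T" and nd: "nondegenerate_process U N Y"
  shows "\<exists>\<phi>. embeds S T M X U N Y \<phi>"
proof -
  obtain ts where ts: "set ts = T" using finite_list[OF T] by blast
  have "\<exists>ps. matching ps \<and> map fst ps = ts" if "set ts \<subseteq> T" for ts
    using that
  proof (induction ts rule: rev_induct)
    case Nil
    then show ?case using matching_Nil by auto
  next
    case (snoc t ts)
    then obtain ps where "matching ps" "map fst ps = ts" by auto
    moreover from this snoc.prems obtain u where "matching (ps @ [(t, u)])"
      using forth unfolding forth_property_def by (meson in_set_conv_decomp subsetD)
    ultimately show ?case by (intro exI[of _ "ps @ [(t, u)]"]) simp
  qed
  then obtain ps where ps: "matching ps" "map fst ps = ts" using ts by blast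
  then have "fst ` set ps = T" using ts by (metis list.set_map)
  with matching_imp_partial_iso[OF ps(1) nd] show ?thesis
    unfolding finite_partial_iso_def by auto
qed

end

text \<open>
  Universality and ultrahomogeneity of each process give one of the two extension properties, so back
  and forth can start from the empty partial isomorphism.
\<close>

theorem urysohn_process_unique:
  fixes X :: "'t \<Rightarrow> 'w \<Rightarrow> 's" and Y :: "'u \<Rightarrow> 'v \<Rightarrow> 's"
  assumes S: "finite S" and X: "urysohn_process S T M X" and Y: "urysohn_process S U N Y"
  shows "\<exists>\<phi>. process_iso S T M X U N Y \<phi>"
proof -
  have "finite_valued_process M S T X" "finite_valued_process N S U Y"
    using S X Y unfolding urysohn_process_def stochastic_process_def
    by (auto simp: finite_valued_process_def finite_valued_process_axioms_def)
  then interpret process_pair S T M X U N Y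
    by (simp add: process_pair_def)
  interpret swap: process_pair S U N Y T M X ..
  have forth_property
    using Y by (intro forth_propertyI_universal_ultrahomogeneous) (auto simp: urysohn_process_def)
  moreover have back_property
    unfolding back_property_iff_swap
    using X by (intro swap.forth_propertyI_universal_ultrahomogeneous) (auto simp: urysohn_process_def)
  ultimately show ?thesis
    using back_and_forth[OF _ _ matching_Nil] X Y by (auto simp: urysohn_process_def)
qed

section \<open>Divisible probability spaces\<close>

locale divisible_prob_space = prob_space +
  assumes divisible: "A \<in> events \<Longrightarrow> 0 \<le> r \<Longrightarrow> r \<le> prob A \<Longrightarrow> \<exists>B \<in> events. B \<subseteq> A \<and> prob B = r"
begin

text \<open>
  Cut the parts off \<open>A\<close> one value at a time. The last value takes whatever is left, which has the
  right mass because the masses add up.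
\<close>

lemma exists_variable_with_law:
  assumes "finite S" "S \<noteq> {}" "A \<in> events" "\<forall>s \<in> S. 0 \<le> p s" "sum p S = prob A"
  shows "\<exists>g \<in> M \<rightarrow>\<^sub>M count_space S. \<forall>s \<in> S. prob {w \<in> A. g w = s} = p s"
  using assms
proof (induction S arbitrary: A rule: finite_ne_induct)
  case (singleton s)
  then have "(\<lambda>_. s) \<in> M \<rightarrow>\<^sub>M count_space {s}" by simp
  then show ?case using singleton by (intro bexI[of _ "\<lambda>_. s"]) auto
next
  case (insert s S)
  have "p s \<le> prob A" using insert.prems insert.hyps sum_nonneg[of S p] by auto
  then obtain B where B: "B \<in> events" "B \<subseteq> A" "prob B = p s"
    using divisible[OF insert.prems(1), of "p s"] insert.prems by auto
  have "sum p S = prob (A - B)"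
    using B insert by (simp add: finite_measure_Diff)
  moreover have "A - B \<in> events" "\<forall>s \<in> S. 0 \<le> p s" using insert.prems B by auto
  ultimately have "\<exists>g \<in> M \<rightarrow>\<^sub>M count_space S. \<forall>s \<in> S. prob {w \<in> A - B. g w = s} = p s"
    by (intro insert.IH)
  then obtain g where
    g: "g \<in> M \<rightarrow>\<^sub>M count_space S" "\<forall>s \<in> S. prob {w \<in> A - B. g w = s} = p s"
    by blast
  have gS: "g w \<in> S" if "w \<in> space M" for w
    using measurable_space[OF g(1) that] by simp
  let ?h = "\<lambda>w. if w \<in> B then s else g w"
  have g': "g \<in> M \<rightarrow>\<^sub>M count_space (insert s S)"
    using measurable_compose[OF g(1), of id "count_space (insert s S)"] by auto
  have h: "?h \<in> M \<rightarrow>\<^sub>M count_space (insert s S)"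
    using B(1) g' by (intro measurable_If) (auto simp: sets.Int_space_eq1)
  have law: "prob {w \<in> A. ?h w = s'} = p s'" if "s' \<in> insert s S" for s'
  proof (cases "s' = s")
    case True
    have "A \<subseteq> space M" by (rule sets.sets_into_space[OF insert.prems(1)])
    then have "{w \<in> A. ?h w = s'} = B"
      using True B(2) gS insert.hyps(3) by auto
    then show ?thesis using True B(3) by simp
  next
    case False
    then have "{w \<in> A. ?h w = s'} = {w \<in> A - B. g w = s'}" by auto
    then show ?thesis using False that g(2) by auto
  qed
  show ?case using law by (intro bexI[OF _ h] ballI)
qed

end

text \<open>
  On every atom of the tuple already placed, the next coordinate must take each value with a
  prescribed probability. Divisibility allows the atom to be cut accordingly.
\<close>

lemma (in process_pair) forth_propertyI_divisible:
  assumes div: "divisible_prob_space N"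
    and full: "\<And>f. f \<in> N \<rightarrow>\<^sub>M count_space S \<Longrightarrow> \<exists>u \<in> U. AE w in N. Y u w = f w"
  shows forth_property
  unfolding forth_property_def
proof (intro allI impI ballI)
  interpret divisible_prob_space N by (rule div)
  fix ps t assume ps: "matching ps" and t: "t \<in> T"
  let ?ts = "map fst ps" and ?us = "map snd ps"
  define E where "E ss = {w \<in> space N. map (\<lambda>u. Y u w) ?us = ss}" for ss
  define p where "p ss s = fdd M X (?ts @ [t]) (ss @ [s])" for ss s
  have "S \<noteq> {}"
    using A.X_in[OF t] A.not_empty by blast
  have ts: "?ts \<in> lists T" "?us \<in> lists U"
    using matching_carrier[OF ps] by auto
  have E: "E ss \<in> B.events" for ss
    unfolding E_def by (rule B.tuple_event[OF ts(2)])
  have "\<exists>g \<in> N \<rightarrow>\<^sub>M count_space S. \<forall>s \<in> S. B.prob {w \<in> E ss. g w = s} = p ss s"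
    if ss: "ss \<in> B.tuples (length ps)" for ss
  proof (rule exists_variable_with_law[OF A.finite_S \<open>S \<noteq> {}\<close> E])
    show "\<forall>s \<in> S. 0 \<le> p ss s" by (simp add: p_def fdd_def)
    have "(\<Sum>s\<in>S. p ss s) = (\<Sum>s\<in>S. A.prob {w \<in> space M. map (\<lambda>t. X t w) (?ts @ [t]) = ss @ [s]})"
      by (simp add: p_def fdd_def)
    also have "\<dots> = A.prob (\<Union>s\<in>S. {w \<in> space M. map (\<lambda>t. X t w) (?ts @ [t]) = ss @ [s]})"
    proof (rule A.finite_measure_finite_Union[symmetric, OF A.finite_S])
      have "{w \<in> space M. map (\<lambda>t. X t w) (?ts @ [t]) = ss @ [s]} \<in> A.events" for s
        using ts t by (intro A.tuple_event) auto
      then show "(\<lambda>s. {w \<in> space M. map (\<lambda>t. X t w) (?ts @ [t]) = ss @ [s]}) ` S \<subseteq> A.events"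
        by blast
    qed (auto simp: disjoint_family_on_def)
    also have "(\<Union>s\<in>S. {w \<in> space M. map (\<lambda>t. X t w) (?ts @ [t]) = ss @ [s]}) =
        {w \<in> space M. map (\<lambda>t. X t w) ?ts = ss}"
      using A.X_in[OF t] by auto
    also have "A.prob \<dots> = B.prob (E ss)"
      using ps ss unfolding matching_def E_def by (simp add: fdd_def B.tuples_def)
    finally show "sum (p ss) S = B.prob (E ss)" .
  qed
  then obtain g where g: "\<And>ss. ss \<in> B.tuples (length ps) \<Longrightarrow> g ss \<in> N \<rightarrow>\<^sub>M count_space S"
    "\<And>ss s. ss \<in> B.tuples (length ps) \<Longrightarrow> s \<in> S \<Longrightarrow> B.prob {w \<in> E ss. g ss w = s} = p ss s"
    by metis
  define f where "f w = g (map (\<lambda>u. Y u w) ?us) w" for w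
  have "f \<in> N \<rightarrow>\<^sub>M count_space S"
    unfolding f_def
  proof (rule measurable_compose_countable'[where f = g])
    show "(\<lambda>w. map (\<lambda>u. Y u w) ?us) \<in> N \<rightarrow>\<^sub>M count_space (B.tuples (length ps))"
      using B.tuple_measurable[OF ts(2)] by simp
  qed (use g(1) B.finite_tuples in \<open>auto intro: countable_finite\<close>)
  then obtain u where u: "u \<in> U" "AE w in N. Y u w = f w"
    using full by blast
  have "matching (ps @ [(t, u)])"
    unfolding matching_def
  proof (intro conjI ballI impI)
    show "set (ps @ [(t, u)]) \<subseteq> T \<times> U" using ps t u by (auto simp: matching_def)
    fix rs assume rs: "rs \<in> lists S" "length rs = length (ps @ [(t, u)])"
    then obtain ss s where ss: "rs = ss @ [s]" by (cases rs rule: rev_cases) auto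
    have sS: "ss \<in> B.tuples (length ps)" "s \<in> S" using rs ss by (auto simp: B.tuples_def)
    have "fdd N Y (?us @ [u]) (ss @ [s]) = B.prob {w \<in> E ss. g ss w = s}"
      unfolding fdd_def
    proof (rule B.finite_measure_eq_AE)
      show "{w \<in> space N. map (\<lambda>u. Y u w) (?us @ [u]) = ss @ [s]} \<in> B.events"
        using ts u by (intro B.tuple_event) auto
      have "{w \<in> E ss. g ss w = s} = E ss \<inter> (g ss -` {s} \<inter> space N)"
        by (auto simp: E_def)
      also have "\<dots> \<in> B.events"
        using g(1)[OF sS(1)] sS(2) by (intro sets.Int E measurable_sets) auto
      finally show "{w \<in> E ss. g ss w = s} \<in> B.events" .
      show "AE w in N. w \<in> {w \<in> space N. map (\<lambda>u. Y u w) (?us @ [u]) = ss @ [s]} \<longleftrightarrow>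
          w \<in> {w \<in> E ss. g ss w = s}"
        using u(2) by eventually_elim (auto simp: E_def f_def)
    qed
    then show "fdd M X (map fst (ps @ [(t, u)])) rs = fdd N Y (map snd (ps @ [(t, u)])) rs"
      using g(2)[OF sS] by (simp add: ss p_def)
  qed
  then show "\<exists>u. matching (ps @ [(t, u)])" ..
qed

section \<open>All random variables on a separable divisible probability space\<close>

text \<open>
  A point of a separable pseudometric space is determined, up to distance zero, by the balls of
  radius \<open>1 / (m + 1)\<close> around a countable dense set that contain it. Their indices form a set of
  natural numbers, and there are only as many of those as real numbers. Thus the real
  numbers suffice as indices of all random variables up to almost sure equality.
\<close>

lemma (in finite_valued_process) separable_real_code:
  assumes D: "countable D" "D \<subseteq> T" "\<And>t e. t \<in> T \<Longrightarrow> e > 0 \<Longrightarrow> \<exists>t'\<in>D. d t t' < e"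
  obtains code :: "'t \<Rightarrow> real" where "\<And>t u. t \<in> T \<Longrightarrow> u \<in> T \<Longrightarrow> code t = code u \<longleftrightarrow> d t u = 0"
proof -
  obtain j :: "nat set \<Rightarrow> real" where j: "bij j"
    using nat_sets_eqpoll_reals unfolding eqpoll_def by blast
  define near where "near t = {(n, m). d t (from_nat_into D n) < inverse (real (Suc m))}" for t
  define code where "code t = j (prod_encode ` near t)" for t
  have code_eq: "code t = code u \<longleftrightarrow> near t = near u" for t u
  proof -
    have "code t = code u \<longleftrightarrow> prod_encode ` near t = prod_encode ` near u"
      using j by (simp add: code_def bij_def inj_eq)
    then show ?thesis by (simp add: inj_image_eq_iff[OF inj_prod_encode])
  qed
  have "near t = near u \<longleftrightarrow> d t u = 0" if tu: "t \<in> T" "u \<in> T" for t u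
  proof
    assume eq: "near t = near u"
    have "d t u \<le> 0 + e" if e: "e > 0" for e
    proof -
      obtain m where m: "inverse (real (Suc m)) < e / 2"
        using reals_Archimedean[of "e / 2"] e by auto
      obtain t' where t': "t' \<in> D" "d t t' < inverse (real (Suc m))"
        using D(3)[OF tu(1), of "inverse (real (Suc m))"] by (auto simp del: of_nat_Suc)
      then obtain n where "t' = from_nat_into D n" using D(1) by (metis from_nat_into_surj)
      with t'(2) have "(n, m) \<in> near t" by (simp add: near_def)
      then have "(n, m) \<in> near u" by (simp only: eq)
      then have "d u t' < inverse (real (Suc m))"
        by (simp add: near_def \<open>t' = from_nat_into D n\<close>)
      moreover have "d t u \<le> d t t' + d t' u"
        using tu t'(1) D(2) by (intro d_triangle) auto
      ultimately show ?thesis using t'(2) m d_commute[of u t'] by linarith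
    qed
    then have "d t u \<le> 0" by (rule field_le_epsilon)
    then show "d t u = 0" using d_nonneg[of t u] by linarith
  next
    assume eq: "d t u = 0"
    have "d t v = d u v" if "v \<in> T" for v
      using d_triangle[of t u v] d_triangle[of u t v] d_commute[of u t] eq tu that by simp
    moreover have "from_nat_into D n \<in> T" for n
    proof -
      have "D \<noteq> {}" using D(3)[OF tu(1), of 1] by auto
      then show ?thesis using from_nat_into[of D n] D(2) by blast
    qed
    ultimately show "near t = near u" by (simp add: near_def)
  qed
  with code_eq show ?thesis using that[of code] by blast
qed

text \<open>
  Separability of the measure algebra, that is of the events under the measure of the symmetric
  difference.
\<close>

locale separable_divisible_prob_space = divisible_prob_space +
  assumes separable: "\<exists>\<B>. countable \<B> \<and> \<B> \<subseteq> events \<and>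
    (\<forall>A \<in> events. \<forall>e>0. \<exists>B \<in> \<B>. prob (sym_diff A B) < e)"

text \<open>
  Approximating events for the different values of a variable may overlap and need not cover the
  space. Taking the first event that applies, and \<open>s0\<close> if none does, still gives a variable.
\<close>

fun first_match :: "('s \<times> 'w set) list \<Rightarrow> 's \<Rightarrow> 'w \<Rightarrow> 's" where
  "first_match [] s0 w = s0"
| "first_match ((s, B) # l) s0 w = (if w \<in> B then s else first_match l s0 w)"

lemma first_match_measurable:
  assumes "finite S" "s0 \<in> S" "set l \<subseteq> S \<times> sets M"
  shows "first_match l s0 \<in> M \<rightarrow>\<^sub>M count_space S"
  using assms(3)
proof (induction l)
  case Nil
  have "first_match [] s0 = (\<lambda>_. s0)" by auto
  then show ?case using assms(2) by simp
next
  case (Cons p l)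
  obtain s B where p: "p = (s, B)" by (cases p)
  have "first_match (p # l) s0 = (\<lambda>w. if w \<in> B then s else first_match l s0 w)"
    by (auto simp: p)
  moreover have "\<dots> \<in> M \<rightarrow>\<^sub>M count_space S"
    using Cons p by (intro measurable_If) (auto simp: sets.Int_space_eq1)
  ultimately show ?case by simp
qed

lemma first_match_eq:
  assumes "x \<in> set sl" "\<And>s. s \<in> set sl \<Longrightarrow> w \<in> B s \<longleftrightarrow> x = s"
  shows "first_match (map (\<lambda>s. (s, B s)) sl) s0 w = x"
  using assms by (induction sl) auto

text \<open>
  The random variables themselves serve as indices here. Variables that are almost surely equal have
  distance zero, so a non-degenerate process arises from one representative of each class.
\<close>

locale space_of_variables = separable_divisible_prob_space M
  for M :: "'w measure" +
  fixes S :: "'s set" and s0 :: 's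
  assumes finite_S: "finite S" and s0: "s0 \<in> S"
begin

abbreviation L :: "('w \<Rightarrow> 's) set" where
  "L \<equiv> M \<rightarrow>\<^sub>M count_space S"

sublocale rv: finite_valued_process M S L "\<lambda>f. f"
  by unfold_locales (rule finite_S)

text \<open>
  A variable and the first-match variable built from approximations of its level sets can only differ
  where some approximation fails.
\<close>

lemma countable_dense_variables:
  obtains D where "countable D" "D \<subseteq> L" "\<And>f e. f \<in> L \<Longrightarrow> e > 0 \<Longrightarrow> \<exists>g \<in> D. rv.d f g < e"
proof -
  obtain \<B> where \<B>: "countable \<B>" "\<B> \<subseteq> events"
    "\<And>A e. A \<in> events \<Longrightarrow> e > 0 \<Longrightarrow> \<exists>B \<in> \<B>. prob (sym_diff A B) < e"
    using separable by metis
  define D where "D = (\<lambda>l. first_match l s0) ` lists (S \<times> \<B>)"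
  have "countable D"
    unfolding D_def using \<B>(1) finite_S
    by (intro countable_image countable_lists countable_SIGMA) (auto intro: countable_finite)
  moreover have "D \<subseteq> L"
    unfolding D_def
  proof (intro image_subsetI first_match_measurable[OF finite_S s0])
    show "set l \<subseteq> S \<times> events" if "l \<in> lists (S \<times> \<B>)" for l
      using that \<B>(2) by auto
  qed
  moreover have "\<exists>g \<in> D. rv.d f g < e" if f: "f \<in> L" and e: "e > 0" for f e
  proof -
    have card: "card S > 0" using finite_S s0 by (auto simp: card_gt_0_iff)
    define A where "A s = f -` {s} \<inter> space M" for s
    have A: "A s \<in> events" if "s \<in> S" for s
      unfolding A_def using that by (intro measurable_sets[OF f]) auto
    have "\<forall>s\<in>S. \<exists>B. B \<in> \<B> \<and> prob (sym_diff (A s) B) < e / card S"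
      using \<B>(3)[OF A, of _ "e / card S"] e card by auto
    from bchoice[OF this] obtain B where
      B: "\<And>s. s \<in> S \<Longrightarrow> B s \<in> \<B>" "\<And>s. s \<in> S \<Longrightarrow> prob (sym_diff (A s) (B s)) < e / card S"
      by blast
    obtain sl where sl: "set sl = S" using finite_list[OF finite_S] by blast
    define g where "g = first_match (map (\<lambda>s. (s, B s)) sl) s0"
    have "map (\<lambda>s. (s, B s)) sl \<in> lists (S \<times> \<B>)" using B(1) sl by auto
    then have "g \<in> D" unfolding g_def D_def by (rule imageI)
    moreover have "rv.d f g < e"
    proof -
      have ev: "sym_diff (A s) (B s) \<in> events" if "s \<in> S" for s
        using A B(1) \<B>(2) that by (intro sets.Un sets.Diff) auto
      have "f w = g w" if w: "w \<in> space M" "\<And>s. s \<in> S \<Longrightarrow> w \<notin> sym_diff (A s) (B s)" for w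
      proof -
        have "f w \<in> S" using measurable_space[OF f w(1)] by simp
        moreover have "w \<in> B s \<longleftrightarrow> f w = s" if "s \<in> S" for s
          using w(1) w(2)[OF that] by (auto simp: A_def)
        ultimately show ?thesis
          unfolding g_def sl[symmetric] by (intro first_match_eq[symmetric]) auto
      qed
      then have "{w \<in> space M. f w \<noteq> g w} \<subseteq> (\<Union>s\<in>S. sym_diff (A s) (B s))"
        by blast
      then have "rv.d f g \<le> prob (\<Union>s\<in>S. sym_diff (A s) (B s))"
        unfolding process_dist_def using ev finite_S
        by (intro finite_measure_mono sets.finite_UN) auto
      also have "\<dots> \<le> (\<Sum>s\<in>S. prob (sym_diff (A s) (B s)))"
        using ev finite_S by (intro finite_measure_subadditive_finite) auto
      also have "\<dots> < card S * (e / card S)"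
        using B(2) card by (rule sum_bounded_above_strict)
      finally show ?thesis using card by simp
    qed
    ultimately show ?thesis by blast
  qed
  ultimately show ?thesis using that by blast
qed

text \<open>
  Completeness is the usual Borel--Cantelli argument. Along a fast subsequence almost every sample
  point sees only finitely many changes of value.
\<close>

lemma variables_complete:
  fixes \<sigma> :: "nat \<Rightarrow> 'w \<Rightarrow> 's"
  assumes \<sigma>: "range \<sigma> \<subseteq> L"
    and cauchy: "\<And>e. e > 0 \<Longrightarrow> \<exists>K. \<forall>m\<ge>K. \<forall>n\<ge>K. rv.d (\<sigma> m) (\<sigma> n) < e"
  obtains f where "f \<in> L" "\<And>e. e > 0 \<Longrightarrow> \<exists>K. \<forall>n\<ge>K. rv.d (\<sigma> n) f < e"
proof -
  have "\<exists>K. \<forall>m\<ge>K. \<forall>n\<ge>K. rv.d (\<sigma> m) (\<sigma> n) < (1/2) ^ k" for k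
    by (rule cauchy) simp
  then obtain K where K: "\<And>k m n. K k \<le> m \<Longrightarrow> K k \<le> n \<Longrightarrow> rv.d (\<sigma> m) (\<sigma> n) < (1/2) ^ k"
    by metis
  \<comment> \<open>The sum is a monotone sequence above \<open>K\<close>, so that consecutive members are close.\<close>
  define r where "r k = (\<Sum>i\<le>k. K i)" for k
  have r: "K k \<le> r k" "r k \<le> r (Suc k)" for k
    unfolding r_def by (auto intro: member_le_sum)
  define g where "g k = \<sigma> (r k)" for k
  have g: "g k \<in> L" for k using \<sigma> by (auto simp: g_def)
  define A where "A k = {w \<in> space M. g k w \<noteq> g (Suc k) w}" for k
  \<comment> \<open>Outside \<open>B k\<close> the subsequence is constant from index \<open>k\<close> on.\<close>
  define B where "B k = (\<Union>j. A (k + j))" for k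
  have A: "A k \<in> events" "prob (A k) \<le> (1/2) ^ k" for k
  proof -
    show "A k \<in> events" unfolding A_def by (rule rv.neq_event[OF g g])
    have "rv.d (g k) (g (Suc k)) < (1/2) ^ k"
      unfolding g_def using r[of k] by (intro K) linarith+
    then show "prob (A k) \<le> (1/2) ^ k" by (simp add: A_def process_dist_def)
  qed
  have B: "B k \<in> events" "prob (B k) \<le> 2 * (1/2) ^ k" for k
  proof -
    show "B k \<in> events" unfolding B_def using A(1) by auto
    have geo: "(\<lambda>j. (1/2) ^ (k + j) :: real) sums ((1/2) ^ k * 2)"
      unfolding power_add by (intro sums_mult) (use geometric_sums[of "1/2::real"] in simp)
    have sm: "summable (\<lambda>j. prob (A (k + j)))"
      by (rule summable_comparison_test[OF _ sums_summable[OF geo]]) (use A(2) in auto)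
    have "prob (B k) \<le> (\<Sum>j. prob (A (k + j)))"
      unfolding B_def using A(1) sm by (intro finite_measure_subadditive_countably) auto
    also have "\<dots> \<le> (\<Sum>j. (1/2) ^ (k + j))"
      using A(2) sm sums_summable[OF geo] by (intro suminf_le) auto
    also have "\<dots> = 2 * (1/2) ^ k" using sums_unique[OF geo] by simp
    finally show "prob (B k) \<le> 2 * (1/2) ^ k" .
  qed
  \<comment> \<open>The subsequence is eventually equal to \<open>s\<close>.\<close>
  define E where "E s = (\<Union>k. \<Inter>j. g (k + j) -` {s} \<inter> space M)" for s
  have E: "E s \<in> events" if "s \<in> S" for s
    unfolding E_def
  proof (intro sets.countable_UN image_subsetI sets.countable_INT)
    show "g (k + j) -` {s} \<inter> space M \<in> events" for k j
      using that by (intro measurable_sets[OF g]) auto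
  qed auto
  have E_unique: "s = s'" if w: "w \<in> E s" "w \<in> E s'" for w s s'
  proof -
    obtain k k' where "\<forall>j. g (k + j) w = s" "\<forall>j. g (k' + j) w = s'"
      using w by (auto simp: E_def)
    then have "g (k + k') w = s" "g (k' + k) w = s'" by blast+
    then show ?thesis by (simp add: add.commute)
  qed
  define f where "f w = (if \<exists>s\<in>S. w \<in> E s then SOME s. s \<in> S \<and> w \<in> E s else s0)" for w
  have f_eq: "f w = s" if "s \<in> S" "w \<in> E s" for w s
  proof -
    have "(SOME s. s \<in> S \<and> w \<in> E s) = s"
      using that E_unique by (intro some_equality) auto
    then show ?thesis using that by (auto simp: f_def)
  qed
  have f_default: "f w = s0" if "w \<notin> (\<Union>s\<in>S. E s)" for w
    using that by (auto simp: f_def)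
  have "f \<in> L"
    unfolding measurable_count_space_eq2[OF finite_S]
  proof (intro conjI ballI)
    show "f \<in> space M \<rightarrow> S"
    proof
      fix w show "f w \<in> S"
        using f_eq f_default s0 by (cases "w \<in> (\<Union>s\<in>S. E s)") auto
    qed
    fix s assume s: "s \<in> S"
    have U: "space M - (\<Union>s\<in>S. E s) \<in> events"
      using E finite_S by (intro sets.Diff sets.finite_UN) auto
    have Esub: "E s \<subseteq> space M" for s by (auto simp: E_def)
    have "f -` {s} \<inter> space M = (if s = s0 then E s \<union> (space M - (\<Union>s\<in>S. E s)) else E s)"
    proof (intro set_eqI)
      fix w
      consider s' where "s' \<in> S" "w \<in> E s'" | "w \<notin> (\<Union>s\<in>S. E s)" by blast
      then show "w \<in> f -` {s} \<inter> space M \<longleftrightarrow>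
          w \<in> (if s = s0 then E s \<union> (space M - (\<Union>s\<in>S. E s)) else E s)"
      proof cases
        case 1
        then have "f w = s'" by (rule f_eq)
        then show ?thesis using 1 Esub E_unique s by auto
      next
        case 2
        then have "f w = s0" by (rule f_default)
        then show ?thesis using 2 s by auto
      qed
    qed
    then show "f -` {s} \<inter> space M \<in> events" using E[OF s] U by auto
  qed
  moreover have "\<exists>K. \<forall>n\<ge>K. rv.d (\<sigma> n) f < e" if e: "e > 0" for e
  proof -
    have fg: "rv.d (g k) f \<le> 2 * (1/2) ^ k" for k
    proof -
      have "g k w = f w" if w: "w \<in> space M" "w \<notin> B k" for w
      proof -
        have "g (k + j) w = g k w" for j
          using w by (induction j) (auto simp: A_def B_def)
        then have "w \<in> E (g k w)" using w(1) unfolding E_def by blast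
        moreover have "g k w \<in> S" using measurable_space[OF g w(1)] by simp
        ultimately show ?thesis by (intro f_eq[symmetric])
      qed
      then have "{w \<in> space M. g k w \<noteq> f w} \<subseteq> B k" by blast
      then have "rv.d (g k) f \<le> prob (B k)"
        unfolding process_dist_def using B(1) by (intro finite_measure_mono)
      with B(2)[of k] show ?thesis by linarith
    qed
    obtain k where k: "(1/2 :: real) ^ k < e / 3"
      using real_arch_pow_inv[of "e / 3" "1/2"] e by auto
    have "rv.d (\<sigma> n) f < e" if n: "n \<ge> r k" for n
    proof -
      have "rv.d (\<sigma> n) f \<le> rv.d (\<sigma> n) (g k) + rv.d (g k) f"
        using \<sigma> g \<open>f \<in> L\<close> by (intro rv.d_triangle) auto
      moreover have "rv.d (\<sigma> n) (g k) < (1/2) ^ k"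
        unfolding g_def using r(1)[of k] n by (intro K) linarith+
      ultimately show ?thesis using fg[of k] k by linarith
    qed
    then show ?thesis by blast
  qed
  ultimately show ?thesis using that by blast
qed

text \<open>
  Divisibility makes every partial isomorphism into the space of all variables extendable. Universality
  follows directly, and ultrahomogeneity follows by back and forth of the process with itself.
\<close>

theorem urysohn_process_exists:
  "\<exists>(T :: real set) X. urysohn_process S T M X"
proof -
  obtain D where D: "countable D" "D \<subseteq> L" "\<And>f e. f \<in> L \<Longrightarrow> e > 0 \<Longrightarrow> \<exists>g \<in> D. rv.d f g < e"
    using countable_dense_variables by blast
  obtain code :: "('w \<Rightarrow> 's) \<Rightarrow> real" where
    code: "\<And>f g. f \<in> L \<Longrightarrow> g \<in> L \<Longrightarrow> code f = code g \<longleftrightarrow> rv.d f g = 0"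
    using rv.separable_real_code[OF D] by blast
  define T where "T = code ` L"
  define X where "X = inv_into L code"
  have XL: "X t \<in> L" if "t \<in> T" for t
    using that unfolding X_def T_def by (rule inv_into_into)
  have codeX: "code (X t) = t" if "t \<in> T" for t
    using that unfolding X_def T_def by (rule f_inv_into_f)
  have Xcode: "rv.d (X (code f)) f = 0" "code f \<in> T" if "f \<in> L" for f
    using code[of "X (code f)" f] codeX[of "code f"] XL[of "code f"] that by (auto simp: T_def)
  interpret proc: finite_valued_process M S T X
    by unfold_locales (auto intro: finite_S XL)
  interpret self: process_pair S T M X T M X ..
  have d_eq: "proc.d t u = rv.d (X t) (X u)" for t u
    by (simp add: process_dist_def)
  have d_code: "rv.d g (X (code f)) \<le> rv.d g f" if "f \<in> L" "g \<in> L" for f g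
    using rv.d_triangle[of g f "X (code f)"] Xcode[OF that(1)] XL[of "code f"] that
    by (simp add: rv.d_commute)
  have nd: "nondegenerate_process T M X"
    unfolding nondegenerate_process_def
  proof (intro ballI impI)
    fix t u assume tu: "t \<in> T" "u \<in> T" "t \<noteq> u"
    then have "rv.d (X t) (X u) \<noteq> 0"
      using code[OF XL XL, of t u] codeX by simp
    then show "proc.d t u > 0" using rv.d_nonneg[of "X t" "X u"] by (simp add: d_eq)
  qed
  interpret metric: Metric_space T "proc.d"
    by (rule Metric_space_process_dist[OF finite_S proc.stochastic_process nd])
  have sep: "separable_process T M X"
    unfolding proc.separable_process_iff[OF nd]
  proof (intro exI conjI ballI allI impI)
    show "countable (code ` D)" "code ` D \<subseteq> T" using D(1,2) by (auto simp: T_def)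
    fix t e :: real assume t: "t \<in> T" and "e > 0"
    then obtain g where g: "g \<in> D" "rv.d (X t) g < e" using D(3)[OF XL] by blast
    then have "proc.d t (code g) < e"
      using d_code[of g "X t"] D(2) XL[OF t] unfolding d_eq by force
    then show "\<exists>t' \<in> code ` D. proc.d t t' < e" using g(1) by blast
  qed
  have compl: "complete_process T M X"
    unfolding complete_process_def metric.mcomplete_def
  proof (intro allI impI)
    fix \<tau> assume \<tau>: "metric.MCauchy \<tau>"
    then have \<tau>T: "\<tau> n \<in> T" for n by (auto simp: metric.MCauchy_def)
    obtain f where f: "f \<in> L" "\<And>e. e > 0 \<Longrightarrow> \<exists>K. \<forall>n\<ge>K. rv.d (X (\<tau> n)) f < e"
    proof (rule variables_complete[of "\<lambda>n. X (\<tau> n)"])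
      show "range (\<lambda>n. X (\<tau> n)) \<subseteq> L" using XL[OF \<tau>T] by blast
      show "\<exists>K. \<forall>m\<ge>K. \<forall>n\<ge>K. rv.d (X (\<tau> m)) (X (\<tau> n)) < e" if "e > 0" for e
        using \<tau> that unfolding metric.MCauchy_def d_eq by meson
    qed blast
    have "proc.d (\<tau> n) (code f) \<le> rv.d (X (\<tau> n)) f" for n
      unfolding d_eq by (rule d_code[OF f(1) XL[OF \<tau>T]])
    then have "limitin metric.mtopology \<tau> (code f) sequentially"
      unfolding metric.limit_metric_sequentially
      using f(2) Xcode(2)[OF f(1)] \<tau>T by (meson le_less_trans)
    then show "\<exists>t. limitin metric.mtopology \<tau> t sequentially" ..
  qed
  have full: "\<exists>t \<in> T. AE w in M. X t w = f w" if f: "f \<in> L" for f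
  proof
    show "code f \<in> T" by (rule Xcode(2)[OF f])
    have "{w \<in> space M. X (code f) w \<noteq> f w} \<in> events"
      using rv.neq_event XL[OF Xcode(2)[OF f]] f by blast
    moreover have "prob {w \<in> space M. X (code f) w \<noteq> f w} = 0"
      using Xcode(1)[OF f] by (simp add: process_dist_def)
    ultimately show "AE w in M. X (code f) w = f w"
      by (subst AE_iff_measurable[OF _ refl]) (auto simp: emeasure_eq_measure)
  qed
  have "universal_process S T M X"
    unfolding universal_process_def
  proof (intro allI impI)
    fix I :: "nat set" and N :: "(nat \<Rightarrow> 's) measure" and Z
    assume I: "finite I" and "stochastic_process S I N Z"
    then interpret Z: finite_valued_process N S I Z
      by (auto simp: stochastic_process_def finite_valued_process_def
          finite_valued_process_axioms_def finite_S)
    interpret pair: process_pair S I N Z T M X ..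
    have pair.forth_property
      by (rule pair.forth_propertyI_divisible[OF divisible_prob_space_axioms full])
    from pair.forth_property_imp_embeds[OF this I nd] show "\<exists>\<phi>. embeds S I N Z T M X \<phi>" .
  qed
  moreover have "ultrahomogeneous_process S T M X"
    unfolding ultrahomogeneous_process_def
  proof (intro allI impI)
    fix T0 \<phi> assume "finite_partial_iso S T M X T M X T0 \<phi>"
    then have T0: "finite T0" "T0 \<subseteq> T" "embeds S T0 M X T M X \<phi>"
      by (auto simp: finite_partial_iso_def)
    obtain ts where ts: "set ts = T0" using finite_list[OF T0(1)] by blast
    then have "ts \<in> lists T0" by auto
    with T0(3) have m: "self.matching (map (\<lambda>t. (t, \<phi> t)) ts)"
      unfolding self.embeds_iff_matching[OF T0(2)] by blast
    have forth: self.forth_property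
      by (rule self.forth_propertyI_divisible[OF divisible_prob_space_axioms full])
    then have bck: self.back_property by (simp add: self.back_property_iff_swap)
    obtain \<psi> where "process_iso S T M X T M X \<psi>" "\<forall>(t, u) \<in> set (map (\<lambda>t. (t, \<phi> t)) ts). \<psi> t = u"
      using self.back_and_forth[OF forth bck m nd sep compl nd sep compl] by blast
    then show "\<exists>\<psi>. process_automorphism S T M X \<psi> \<and> (\<forall>t\<in>T0. \<psi> t = \<phi> t)"
      unfolding process_automorphism_def ts[symmetric] by auto
  qed
  ultimately show ?thesis
    using proc.stochastic_process nd sep compl unfolding urysohn_process_def by blast
qed

end

section \<open>A suitable sample space\<close>

text \<open>
  An event is close to an open superset, and an open set is close to a finite union of members of a
  countable basis.
\<close>

lemma borel_measure_approx_by_countable_class: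
  fixes M :: "'a :: {second_countable_topology, complete_space} measure"
  assumes "finite_measure M" and sets: "sets M = sets borel"
  shows "\<exists>\<B>. countable \<B> \<and> \<B> \<subseteq> sets M \<and>
    (\<forall>A \<in> sets M. \<forall>e>0. \<exists>B \<in> \<B>. measure M (sym_diff A B) < e)"
proof -
  interpret finite_measure M by (rule assms(1))
  obtain \<C> :: "'a set set" where \<C>: "countable \<C>" "topological_basis \<C>"
    using ex_countable_basis by blast
  define \<B> where "\<B> = Union ` {F. finite F \<and> F \<subseteq> \<C>}"
  have open_sets: "U \<in> sets M" if "open U" for U using that by (simp add: sets)
  have "countable \<B>"
    unfolding \<B>_def using \<C>(1) by (intro countable_image countable_Collect_finite_subset)
  moreover have "\<B> \<subseteq> sets M"
    unfolding \<B>_def using topological_basis_open[OF \<C>(2)]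
    by (auto intro!: open_sets open_Union)
  moreover have "\<exists>B \<in> \<B>. measure M (sym_diff A B) < e" if A: "A \<in> sets M" and e: "e > 0" for A e
  proof -
    have "(INF U \<in> {U. A \<subseteq> U \<and> open U}. emeasure M U) = emeasure M A"
      using A by (intro outer_regular[OF sets, symmetric]) (auto simp: sets emeasure_eq_measure)
    also have "\<dots> < emeasure M A + ennreal (e / 2)"
      using e by (simp add: emeasure_eq_measure ennreal_less_iff flip: ennreal_plus)
    finally obtain U where U: "A \<subseteq> U" "open U" "emeasure M U < emeasure M A + ennreal (e / 2)"
      by (auto simp: INF_less_iff)
    have Um: "U \<in> sets M" using U(2) by (rule open_sets)
    have UA: "measure M U < measure M A + e / 2"
      using U(3) e by (simp add: emeasure_eq_measure ennreal_less_iff flip: ennreal_plus)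
    obtain \<U> where \<U>: "\<U> \<subseteq> \<C>" "\<Union>\<U> = U"
      using \<C>(2) U(2) unfolding topological_basis_def by blast
    have "countable \<U>" using \<U>(1) \<C>(1) by (rule countable_subset)
    define F where "F n = (\<Union>V \<in> {V \<in> \<U>. to_nat_on \<U> V < n}. V)" for n
    have F\<B>: "F n \<in> \<B>" for n
    proof -
      have "inj_on (to_nat_on \<U>) {V \<in> \<U>. to_nat_on \<U> V < n}"
        using \<open>countable \<U>\<close> by (auto intro: inj_on_subset[OF inj_on_to_nat_on])
      then have "finite {V \<in> \<U>. to_nat_on \<U> V < n}"
        by (rule inj_on_finite[where B = "{..<n}"]) auto
      then show ?thesis unfolding \<B>_def F_def using \<U>(1) by (intro image_eqI[OF _ CollectI]) auto
    qed
    then have Fm: "F n \<in> sets M" for n using \<open>\<B> \<subseteq> sets M\<close> by blast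
    have "incseq F" by (auto simp: incseq_def F_def intro: less_le_trans)
    moreover have "(\<Union>n. F n) = U" using \<U>(2) by (auto simp: F_def)
    ultimately have "(\<lambda>n. measure M (F n)) \<longlonglongrightarrow> measure M U"
      using finite_Lim_measure_incseq[of F] Fm by auto
    then have "\<forall>\<^sub>F n in sequentially. measure M U - e / 2 < measure M (F n)"
      using e by (intro order_tendstoD) auto
    then obtain n where n: "measure M U - e / 2 < measure M (F n)"
      by (auto simp: eventually_sequentially)
    have FU: "F n \<subseteq> U" using \<open>(\<Union>n. F n) = U\<close> by blast
    have "measure M (sym_diff A (F n)) \<le> measure M ((U - F n) \<union> (U - A))"
      using U(1) FU A Um Fm by (intro finite_measure_mono) auto
    also have "\<dots> \<le> measure M (U - F n) + measure M (U - A)"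
      using A Um Fm by (intro measure_Un_le) auto
    also have "\<dots> = (measure M U - measure M (F n)) + (measure M U - measure M A)"
      using U(1) FU A Um Fm by (simp add: finite_measure_Diff)
    also have "\<dots> < e" using n UA by linarith
    finally show ?thesis using F\<B> by blast
  qed
  ultimately show ?thesis by blast
qed

abbreviation unit_interval_measure :: "real measure" where
  "unit_interval_measure \<equiv> uniform_measure lborel {0..1}"

lemma prob_space_unit_interval: "prob_space unit_interval_measure"
  by (rule prob_space_uniform_measure) auto

lemma unit_interval_Ioc_le:
  assumes "x \<le> y"
  shows "measure unit_interval_measure {x<..y} \<le> y - x"
proof -
  have "measure unit_interval_measure {x<..y} = measure lborel ({0..1} \<inter> {x<..y})"
    by (subst measure_uniform_measure) auto
  also have "\<dots> \<le> measure lborel {x<..y}"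
    using assms by (intro measure_mono_fmeasurable) (auto simp: fmeasurable_def)
  finally show ?thesis using assms by simp
qed

text \<open>
  The mass of \<open>A\<close> to the left of a point grows continuously as the point moves, so the intermediate
  value theorem finds a cut at every prescribed mass.
\<close>

lemma unit_interval_divisible:
  assumes A: "A \<in> sets unit_interval_measure" and r: "0 \<le> r" "r \<le> measure unit_interval_measure A"
  shows "\<exists>B \<in> sets unit_interval_measure. B \<subseteq> A \<and> measure unit_interval_measure B = r"
proof -
  let ?M = "unit_interval_measure"
  interpret prob_space ?M by (rule prob_space_unit_interval)
  have Ab: "A \<in> sets borel" using A by simp
  define h where "h x = prob (A \<inter> {..x})" for x
  have diff: "h y - h x \<le> y - x" "h x \<le> h y" if "x \<le> y" for x y
  proof -
    show mono: "h x \<le> h y"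
      unfolding h_def using Ab that by (intro finite_measure_mono) auto
    have "h y = prob ((A \<inter> {..x}) \<union> (A \<inter> {x<..y}))"
      unfolding h_def using that by (intro arg_cong[where f = prob]) auto
    also have "\<dots> = h x + prob (A \<inter> {x<..y})"
      unfolding h_def using Ab by (intro finite_measure_Union) auto
    also have "prob (A \<inter> {x<..y}) \<le> prob {x<..y}"
      by (intro finite_measure_mono) auto
    also note unit_interval_Ioc_le[OF that]
    finally show "h y - h x \<le> y - x" by simp
  qed
  have "1-lipschitz_on UNIV h"
  proof (rule lipschitz_onI)
    fix x y :: real
    show "dist (h x) (h y) \<le> 1 * dist x y"
      using diff[of x y] diff[of y x] by (cases "x \<le> y") (auto simp: dist_real_def)
  qed simp
  then have "continuous_on {0..1} h"
    by (meson continuous_on_subset lipschitz_on_continuous_on subset_UNIV)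
  moreover have "h 0 = 0"
  proof -
    have "h 0 \<le> prob {..0}"
      unfolding h_def by (intro finite_measure_mono) auto
    also have "\<dots> = measure lborel ({0..1} \<inter> {..0 :: real})"
      by (subst measure_uniform_measure) auto
    also have "{0..1} \<inter> {..0 :: real} = {0}" by auto
    finally show ?thesis by (simp add: h_def measure_le_0_iff)
  qed
  moreover have "h 1 = prob A"
  proof -
    have "{0..1} \<inter> (A \<inter> {..1}) = {0..1} \<inter> A" by auto
    then show ?thesis unfolding h_def using Ab by (simp add: measure_uniform_measure)
  qed
  ultimately obtain x where "h x = r"
    using IVT'[of h 0 r 1] r by auto
  then show ?thesis using Ab by (intro bexI[of _ "A \<inter> {..x}"]) (auto simp: h_def)
qed

lemma separable_divisible_unit_interval: "separable_divisible_prob_space unit_interval_measure"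
proof -
  interpret prob_space unit_interval_measure by (rule prob_space_unit_interval)
  show ?thesis
  proof
    show "\<exists>\<B>. countable \<B> \<and> \<B> \<subseteq> events \<and> (\<forall>A \<in> events. \<forall>e>0. \<exists>B \<in> \<B>. prob (sym_diff A B) < e)"
      by (rule borel_measure_approx_by_countable_class) (unfold_locales, simp)
  qed (rule unit_interval_divisible)
qed

lemma separable_divisible_embed_measure:
  assumes M: "separable_divisible_prob_space M" and f: "inj f"
  shows "separable_divisible_prob_space (embed_measure M f)"
proof -
  interpret separable_divisible_prob_space M by (rule M)
  let ?N = "embed_measure M f"
  have sets_N: "sets ?N = {f ` A |A. A \<in> events}"
    by (rule sets_embed_measure[OF f])
  have measure_N: "measure ?N (f ` A) = prob A" if "A \<in> events" for A
    using emeasure_embed_measure_image[OF f that] by (simp add: measure_def)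
  have sym: "sym_diff (f ` A) (f ` B) = f ` sym_diff A B" for A B
    using f by (auto simp: inj_def)
  show ?thesis
  proof (intro separable_divisible_prob_space.intro divisible_prob_space.intro prob_spaceI
      divisible_prob_space_axioms.intro separable_divisible_prob_space_axioms.intro)
    have "emeasure ?N (f ` space M) = 1"
      using emeasure_embed_measure_image[OF f, of "space M" M] by (simp add: emeasure_space_1)
    then show "emeasure ?N (space ?N) = 1" by (simp add: space_embed_measure)
  next
    fix A r assume "A \<in> sets ?N" "0 \<le> r" "r \<le> measure ?N A"
    then obtain A' where A': "A' \<in> events" "A = f ` A'" "r \<le> prob A'"
      by (auto simp: sets_N measure_N)
    then obtain B where "B \<in> events" "B \<subseteq> A'" "prob B = r"
      using divisible \<open>0 \<le> r\<close> by blast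
    then show "\<exists>B \<in> sets ?N. B \<subseteq> A \<and> measure ?N B = r"
      using A'(2) by (intro bexI[of _ "f ` B"]) (auto simp: measure_N in_sets_embed_measure)
  next
    obtain \<B> where \<B>: "countable \<B>" "\<B> \<subseteq> events"
      "\<forall>A \<in> events. \<forall>e>0. \<exists>B \<in> \<B>. prob (sym_diff A B) < e"
      using separable by blast
    have "\<exists>B \<in> image f ` \<B>. measure ?N (sym_diff A B) < e" if A: "A \<in> sets ?N" and e: "e > 0" for A e
    proof -
      obtain A' where A': "A' \<in> events" "A = f ` A'" using A by (auto simp: sets_N)
      then obtain B where B: "B \<in> \<B>" "prob (sym_diff A' B) < e" using \<B>(3) e by blast
      then have "measure ?N (sym_diff A (f ` B)) < e"
        unfolding A'(2) sym using A'(1) \<B>(2) by (subst measure_N) auto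
      then show ?thesis using B(1) by blast
    qed
    moreover have "image f ` \<B> \<subseteq> sets ?N" using \<B>(2) by (auto simp: in_sets_embed_measure)
    ultimately show "\<exists>\<B>. countable \<B> \<and> \<B> \<subseteq> sets ?N \<and>
        (\<forall>A \<in> sets ?N. \<forall>e>0. \<exists>B \<in> \<B>. measure ?N (sym_diff A B) < e)"
      using \<B>(1) by (intro exI[of _ "image f ` \<B>"]) auto
  qed
qed

section \<open>Existence and uniqueness\<close>

text \<open>
  Two different values give at least as many paths as there are real numbers, hence enough room for a copy of
  the unit interval in the path space.
\<close>

lemma urysohn_process_exists_two_values:
  fixes S :: "'s set"
  assumes S: "finite S" and ab: "a \<in> S" "b \<in> S" "a \<noteq> b"
  shows "\<exists>(T :: real set) (M :: (real \<Rightarrow> 's) measure) X. urysohn_process S T M X"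
proof -
  define \<iota> :: "real \<Rightarrow> real \<Rightarrow> 's" where "\<iota> x y = (if y = x then a else b)" for x y
  have "inj \<iota>"
  proof (rule injI)
    fix x y assume "\<iota> x = \<iota> y"
    then have "\<iota> x x = \<iota> y x" by simp
    with ab(3) show "x = y" by (simp add: \<iota>_def split: if_splits)
  qed
  then interpret separable_divisible_prob_space "embed_measure unit_interval_measure \<iota>"
    by (rule separable_divisible_embed_measure[OF separable_divisible_unit_interval])
  interpret space_of_variables "embed_measure unit_interval_measure \<iota>" S a
    by unfold_locales (use S ab in auto)
  show ?thesis using urysohn_process_exists by blast
qed

text \<open>
  With at most one value all variables agree, and a non-degenerate process has at most one index. It
  has none if there is no value at all.
\<close>

lemma urysohn_process_exists_one_value:
  fixes S :: "'s set"
  assumes S: "S \<subseteq> {s}"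
  shows "\<exists>(T :: real set) (M :: (real \<Rightarrow> 's) measure) X. urysohn_process S T M X"
proof -
  define T :: "real set" where "T = (if S = {} then {} else {0})"
  define M :: "(real \<Rightarrow> 's) measure" where "M = return (count_space UNIV) (\<lambda>_. s)"
  define X :: "real \<Rightarrow> (real \<Rightarrow> 's) \<Rightarrow> 's" where "X = (\<lambda>_ _. s)"
  have fin: "finite S" using S finite_subset by blast
  interpret prob_space M unfolding M_def by (rule prob_space_return) simp
  have proc: "stochastic_process S T M X"
    unfolding stochastic_process_def X_def T_def using S prob_space_axioms by auto
  have nd: "nondegenerate_process T M X"
    by (simp add: nondegenerate_process_def T_def)
  interpret proc: finite_valued_process M S T X
    using fin proc by unfold_locales (auto simp: stochastic_process_def)
  interpret Metric_space T "process_dist M X"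
    by (rule Metric_space_process_dist[OF fin proc nd])
  have sep: "separable_process T M X"
    unfolding proc.separable_process_iff[OF nd]
    by (intro exI[of _ T]) (auto simp: T_def proc.d_refl)
  have "compact_space mtopology"
    unfolding compact_space_def topspace_mtopology
    by (intro finite_imp_compactin) (simp_all only: topspace_mtopology order_refl, simp add: T_def)
  then have compl: "complete_process T M X"
    unfolding complete_process_def by (rule compact_space_imp_mcomplete)
  have fdd_1: "fdd N Z ts ss = 1"
    if Z: "prob_space N" "\<forall>i \<in> set ts. \<forall>w \<in> space N. Z i w = s"
      and ss: "ss \<in> lists S" "length ss = length ts" for N :: "'v measure" and Z :: "'i \<Rightarrow> 'v \<Rightarrow> 's" and ts ss
  proof -
    have "map (\<lambda>t. Z t w) ts = ss" if "w \<in> space N" for w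
    proof (rule nth_equalityI)
      fix i assume "i < length (map (\<lambda>t. Z t w) ts)"
      then have "ss ! i \<in> S" "ts ! i \<in> set ts" using ss by auto
      then show "map (\<lambda>t. Z t w) ts ! i = ss ! i" using S Z(2) that \<open>i < _\<close> by auto
    qed (simp add: ss)
    then have "{w \<in> space N. map (\<lambda>t. Z t w) ts = ss} = space N" by auto
    then show ?thesis using Z(1) by (simp add: fdd_def prob_space.prob_space)
  qed
  have "universal_process S T M X"
    unfolding universal_process_def
  proof (intro allI impI)
    fix I :: "nat set" and N :: "(nat \<Rightarrow> 's) measure" and Z
    assume "finite I" and Z: "stochastic_process S I N Z"
    have N: "prob_space N" using Z by (simp add: stochastic_process_def)
    have ZS: "Z i w \<in> S" if "i \<in> I" "w \<in> space N" for i w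
      using Z that measurable_space[of "Z i" N "count_space S" w] by (auto simp: stochastic_process_def)
    have "S \<noteq> {}" if "i \<in> I" for i
      using ZS[OF that] prob_space.not_empty[OF N] by blast
    then have "(\<lambda>_. 0) \<in> I \<rightarrow> T" by (auto simp: T_def)
    moreover have "fdd M (\<lambda>_. X 0) ts ss = fdd N Z ts ss"
      if "ts \<in> lists I" "ss \<in> lists S" "length ss = length ts" for ts ss
    proof -
      have "fdd M (\<lambda>_. X 0) ts ss = 1"
        using that(2,3) by (intro fdd_1 prob_space_axioms) (auto simp: X_def)
      moreover have "fdd N Z ts ss = 1"
        using that S ZS by (intro fdd_1 N) blast+
      ultimately show ?thesis by simp
    qed
    ultimately have "embeds S I N Z T M X (\<lambda>_. 0)" by (simp add: embeds_def)
    then show "\<exists>\<phi>. embeds S I N Z T M X \<phi>" by blast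
  qed
  moreover have "ultrahomogeneous_process S T M X"
    unfolding ultrahomogeneous_process_def
  proof (intro allI impI)
    fix T0 \<phi> assume "finite_partial_iso S T M X T M X T0 \<phi>"
    then have sub: "T0 \<subseteq> T" and \<phi>: "\<phi> \<in> T0 \<rightarrow> T"
      by (auto simp: finite_partial_iso_def embeds_def)
    have T: "t \<in> T \<Longrightarrow> t = 0" for t by (simp add: T_def split: if_splits)
    have "id t = \<phi> t" if "t \<in> T0" for t
      using T[OF subsetD[OF sub that]] T[OF funcset_mem[OF \<phi> that]] by simp
    moreover have "process_automorphism S T M X id"
      by (simp add: process_automorphism_def process_iso_def embeds_def)
    ultimately show "\<exists>\<psi>. process_automorphism S T M X \<psi> \<and> (\<forall>t\<in>T0. \<psi> t = \<phi> t)" by blast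
  qed
  ultimately show ?thesis
    using proc nd sep compl unfolding urysohn_process_def by blast
qed

theorem corollary20:
  fixes S :: "'s set"
  assumes "finite S"
  shows "(\<exists>(T :: real set) (M :: (real \<Rightarrow> 's) measure) X. urysohn_process S T M X) \<and>
    (\<forall>(T :: 't set) (M :: 'w measure) X (U :: 'u set) (N :: 'v measure) Y.
       urysohn_process S T M X \<longrightarrow> urysohn_process S U N Y \<longrightarrow>
       (\<exists>\<phi>. process_iso S T M X U N Y \<phi>))"
proof (intro conjI allI impI)
  show "\<exists>(T :: real set) (M :: (real \<Rightarrow> 's) measure) X. urysohn_process S T M X"
  proof (cases "\<exists>a\<in>S. \<exists>b\<in>S. a \<noteq> b")
    case True
    then show ?thesis using urysohn_process_exists_two_values[OF assms] by blast
  next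
    case False
    then obtain s where "S \<subseteq> {s}" by (cases "S = {}") auto
    then show ?thesis by (rule urysohn_process_exists_one_value)
  qed
qed (rule urysohn_process_unique[OF assms])

end
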